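(* Let $(T,f)$ and $(G,g)$ be merge trees with associated metric merge trees $\mathbf{T}$ and $\mathbf{G}$. Then the interleaving distance is the minimal cost of a coupling: $$d_I(\mathbf{T},\mathbf{G})=\min_{C\in\mathcal{C}(T,G)}\|C\|_\infty .$$
   Context: **Merge trees.** A merge tree $(T,f)$ is a finite rooted tree with vertex set $V_T$ and root $r_T$, the root having order (number of incident edges) $>1$, together with an injective function $f:V_T\to\mathbb{R}$ which is strictly increasing for the partial order on $V_T$ generated by child $<$ father (so $r_T$ is the maximum). $\mathrm{LCA}$ denotes the least common ancestor (least upper bound) of a set of vertices. The metric merge tree $\mathbf{T}$ is obtained by gluing, along common vertices, an interval $[f(x),f(x')]$ for each edge from a child $x$ to its father $x'$, and a half-line $[f(r_T),+\infty)$ at the root. It carries the shortest path metric, contains $V_T$, and $f$ and the partial order extend to it (for each $x$ the set $\{x'\ge x\}$ is a chain mapped by $f$ bijectively onto $[f(x),+\infty)$). For $k\ge 0$, $s_T^k(x)$ is the unique $x'\ge x$ with $f(x')=f(x)+k$. **Interleaving distance.** Continuous maps $\alpha:\mathbf{T}\to\mathbf{G}$, $\beta:\mathbf{G}\to\mathbf{T}$ are $\varepsilon$-compatible ($\varepsilon\ge0$) if $g(\alpha(x))=f(x)+\varepsilon$ for all $x\in\mathbf{T}$, $f(\beta(y))=g(y)+\varepsilon$ for all $y\in\mathbf{G}$, $\alpha\beta=s_G^{2\varepsilon}$ and $\beta\alpha=s_T^{2\varepsilon}$. $d_I(\mathbf{T},\mathbf{G})=\inf\{\varepsilon\mid\text{there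 exist }\varepsilon\text{-compatible maps}\}$. **Couplings.** For $C\subset V_T\times V_G$ with projections $\pi_T,\pi_G$, let $\Lambda_C^T(v)$ be the set of maximal elements of $\{v'\in\pi_T(C)\mid v'<v\}$ (possibly empty); similarly $\Lambda_C^G$. Order $C$ by $(a,b)<(c,d)$ iff $a<c$ and $b<d$. $C$ is a coupling, $C\in\mathcal{C}(T,G)$, if: (C1) $\#\max C=1$ (equivalently $\#\max\pi_T(C)=\#\max\pi_G(C)=1$); (C2) $\pi_T$ and $\pi_G$ are injective on $C$; (C3) for $(a,b),(c,d)\in C$, $a<c$ iff $b<d$; (C4) $a\in\pi_T(C)$ implies $\#\Lambda_C^T(a)\ne 1$, and the same for $G$. The unused vertices are $U_C^T=\{v\in V_T\mid \#\Lambda_C^T(v)=1\}$, the deleted ones are $D_C^T=\{v\in V_T\mid v\notin\pi_T(C),\ \#\Lambda_C^T(v)\neq 1\}$; $V_T$ is the disjoint union of $\pi_T(C),U_C^T,D_C^T$. Same for $G$. **The vertex maps.** For $x\in V_T$ let: $\varphi(x)=\min\{v\in V_T\mid v>x,\ \exists v'\le v \text{ with } v'\in\pi_T(C)\}$; $\eta(x)\in V_G$ the vertex $w$ minimizing $g(w)$ among all $(v,w)\in C$ with $v\le\varphi(x)$; $\chi(x)=\mathrm{LCA}\{w\mid (v,w)\in C,\ v\in\Lambda_C^T(x)\}\in V_G$. Define $\alpha_C:V_T-U_C^T\to\mathbf{G}$ by: $\alpha_C(x)=y$ if $(x,y)\in C$; if $x\in D_C^T$ and $\#\Lambda_C^T(x)=0$,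 $\alpha_C(x)$ is the point of $\mathbf{G}$ above $\eta(x)$ at height $\max\{g(\eta(x)),\tfrac12(f(x)+f(\varphi(x)))\}$; if $x\in D_C^T$ and $\#\Lambda_C^T(x)>1$, $\alpha_C(x)=\chi(x)$. The map $\beta_C:V_G-U_C^G\to\mathbf{T}$ is defined in the same way exchanging the roles of $(T,f)$ and $(G,g)$. **Cost.** $\|C\|_\infty=\max\{\max_{x\in V_T-U_C^T}|g(\alpha_C(x))-f(x)|,\ \max_{y\in V_G-U_C^G}|f(\beta_C(y))-g(y)|\}$. *)

theory Defs
  imports "HOL-Analysis.Analysis"
begin

section \<open>Merge trees\<close>

text \<open>Edges are pairs (child, father).\<close>

record 'a mtree =
  verts :: "'a set"
  edges :: "('a \<times> 'a) set"
  root :: 'a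
  height :: "'a \<Rightarrow> real"

abbreviation tle :: "'a mtree \<Rightarrow> 'a \<Rightarrow> 'a \<Rightarrow> bool" where
  "tle T x y \<equiv> (x, y) \<in> (edges T)\<^sup>*"

abbreviation tless :: "'a mtree \<Rightarrow> 'a \<Rightarrow> 'a \<Rightarrow> bool" where
  "tless T x y \<equiv> (x, y) \<in> (edges T)\<^sup>+"

locale merge_tree =
  fixes T :: "'a mtree"
  assumes finite_verts: "finite (verts T)"
    and root_in_verts: "root T \<in> verts T"
    and edges_subset: "edges T \<subseteq> verts T \<times> verts T"
    and root_no_father: "(root T, p) \<notin> edges T"
    and unique_father: "v \<in> verts T \<Longrightarrow> v \<noteq> root T \<Longrightarrow> \<exists>!p. (v, p) \<in> edges T"
    and below_root: "v \<in> verts T \<Longrightarrow> tle T v (root T)"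
    and root_order: "card {e \<in> edges T. fst e = root T \<or> snd e = root T} > 1"
    and height_inj: "inj_on (height T) (verts T)"
    and height_strict_mono: "tless T x y \<Longrightarrow> height T x < height T y"

definition is_lub :: "'a mtree \<Rightarrow> 'a set \<Rightarrow> 'a \<Rightarrow> bool" where
  "is_lub T A u \<longleftrightarrow> u \<in> verts T \<and> (\<forall>a\<in>A. tle T a u) \<and>
     (\<forall>u'\<in>verts T. (\<forall>a\<in>A. tle T a u') \<longrightarrow> tle T u u')"

definition LCA :: "'a mtree \<Rightarrow> 'a set \<Rightarrow> 'a" where
  "LCA T A = (THE u. is_lub T A u)"

section \<open>Metric merge trees\<close>

text \<open>A point of the glued space is encoded by its unique representative \<open>(v, h)\<close>, where \<open>h\<close> is
  its height and \<open>v\<close> is the lower end of the edge (or of the half-line, if \<open>v\<close> is the root)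
  containing it. The upper end of an edge is excluded here, because gluing identifies it
  with the father of \<open>v\<close>; it is put back in the closed segment \<open>mseg T v\<close>.\<close>

type_synonym 'a mpoint = "'a \<times> real"

definition mpoints :: "'a mtree \<Rightarrow> 'a mpoint set" where
  "mpoints T = {(v, h). v \<in> verts T \<and> height T v \<le> h \<and> (\<forall>p. (v, p) \<in> edges T \<longrightarrow> h < height T p)}"

definition vpoint :: "'a mtree \<Rightarrow> 'a \<Rightarrow> 'a mpoint" where
  "vpoint T v = (v, height T v)"

definition mheight :: "'a mpoint \<Rightarrow> real" where
  "mheight x = snd x"

definition mle :: "'a mtree \<Rightarrow> 'a mpoint \<Rightarrow> 'a mpoint \<Rightarrow> bool" where
  "mle T x y \<longleftrightarrow> x \<in> mpoints T \<and> y \<in> mpoints T \<and> tle T (fst x) (fst y) \<and> mheight x \<le> mheight y"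

definition mseg :: "'a mtree \<Rightarrow> 'a \<Rightarrow> 'a mpoint set" where
  "mseg T v = {x \<in> mpoints T. fst x = v} \<union> vpoint T ` {p. (v, p) \<in> edges T}"

text \<open>Shortest path metric: infimum of the lengths of the finite chains of points in which any two
  consecutive points lie on a common closed segment. The value off the carrier is a dummy
  chosen because \<^locale>\<open>Metric_space\<close> asks for symmetry and nonnegativity everywhere.\<close>

definition mchain :: "'a mtree \<Rightarrow> 'a mpoint \<Rightarrow> 'a mpoint \<Rightarrow> 'a mpoint list \<Rightarrow> bool" where
  "mchain T x y ps \<longleftrightarrow> ps \<noteq> [] \<and> hd ps = x \<and> last ps = y \<and>
     successively (\<lambda>p q. \<exists>v\<in>verts T. p \<in> mseg T v \<and> q \<in> mseg T v) ps"

definition chain_length :: "'a mpoint list \<Rightarrow> real" where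
  "chain_length ps = (\<Sum>(p, q)\<leftarrow>zip ps (tl ps). \<bar>mheight p - mheight q\<bar>)"

definition mdist :: "'a mtree \<Rightarrow> 'a mpoint \<Rightarrow> 'a mpoint \<Rightarrow> real" where
  "mdist T x y =
     (if x \<in> mpoints T \<and> y \<in> mpoints T then Inf (chain_length ` {ps. mchain T x y ps}) else 0)"

definition mtop :: "'a mtree \<Rightarrow> 'a mpoint topology" where
  "mtop T = Metric_space.mtopology (mpoints T) (mdist T)"

definition point_above :: "'a mtree \<Rightarrow> 'a mpoint \<Rightarrow> real \<Rightarrow> 'a mpoint" where
  "point_above T x h = (THE x'. mle T x x' \<and> mheight x' = h)"

definition shift :: "'a mtree \<Rightarrow> real \<Rightarrow> 'a mpoint \<Rightarrow> 'a mpoint" where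
  "shift T k x = point_above T x (mheight x + k)"

section \<open>Interleaving distance\<close>

definition compatible_maps ::
  "'a mtree \<Rightarrow> 'b mtree \<Rightarrow> real \<Rightarrow> ('a mpoint \<Rightarrow> 'b mpoint) \<Rightarrow> ('b mpoint \<Rightarrow> 'a mpoint) \<Rightarrow> bool" where
  "compatible_maps T G \<epsilon> \<alpha> \<beta> \<longleftrightarrow>
     continuous_map (mtop T) (mtop G) \<alpha> \<and>
     continuous_map (mtop G) (mtop T) \<beta> \<and>
     \<alpha> \<in> mpoints T \<rightarrow> mpoints G \<and>
     \<beta> \<in> mpoints G \<rightarrow> mpoints T \<and>
     (\<forall>x\<in>mpoints T. mheight (\<alpha> x) = mheight x + \<epsilon>) \<and>
     (\<forall>y\<in>mpoints G. mheight (\<beta> y) = mheight y + \<epsilon>) \<and>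
     (\<forall>y\<in>mpoints G. \<alpha> (\<beta> y) = shift G (2 * \<epsilon>) y) \<and>
     (\<forall>x\<in>mpoints T. \<beta> (\<alpha> x) = shift T (2 * \<epsilon>) x)"

definition interleaving_distance :: "'a mtree \<Rightarrow> 'b mtree \<Rightarrow> real" where
  "interleaving_distance T G = Inf {\<epsilon>. 0 \<le> \<epsilon> \<and> (\<exists>\<alpha> \<beta>. compatible_maps T G \<epsilon> \<alpha> \<beta>)}"

section \<open>Couplings\<close>

text \<open>Every notion attached to \<open>C\<close> is defined on the side of its first projection; the version for
  the second projection is obtained from the converse relation \<open>C\<inverse>\<close>.\<close>

definition Lambda :: "'a mtree \<Rightarrow> ('a \<times> 'b) set \<Rightarrow> 'a \<Rightarrow> 'a set" where
  "Lambda T C v = {u \<in> fst ` C. tless T u v \<and> \<not> (\<exists>u'\<in>fst ` C. tless T u' v \<and> tless T u u')}"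

definition pair_less :: "'a mtree \<Rightarrow> 'b mtree \<Rightarrow> 'a \<times> 'b \<Rightarrow> 'a \<times> 'b \<Rightarrow> bool" where
  "pair_less T G p q \<longleftrightarrow> tless T (fst p) (fst q) \<and> tless G (snd p) (snd q)"

definition couplings :: "'a mtree \<Rightarrow> 'b mtree \<Rightarrow> ('a \<times> 'b) set set" where
  "couplings T G = {C. C \<subseteq> verts T \<times> verts G \<and>
     card {p \<in> C. \<not> (\<exists>q\<in>C. pair_less T G p q)} = 1 \<and>
     inj_on fst C \<and> inj_on snd C \<and>
     (\<forall>(a, b)\<in>C. \<forall>(c, d)\<in>C. tless T a c \<longleftrightarrow> tless G b d) \<and>
     (\<forall>a\<in>fst ` C. card (Lambda T C a) \<noteq> 1) \<and>
     (\<forall>b\<in>snd ` C. card (Lambda G (C\<inverse>) b) \<noteq> 1)}"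

definition unused :: "'a mtree \<Rightarrow> ('a \<times> 'b) set \<Rightarrow> 'a set" where
  "unused T C = {v \<in> verts T. card (Lambda T C v) = 1}"

definition deleted :: "'a mtree \<Rightarrow> ('a \<times> 'b) set \<Rightarrow> 'a set" where
  "deleted T C = {v \<in> verts T. v \<notin> fst ` C \<and> card (Lambda T C v) \<noteq> 1}"

section \<open>The vertex maps and the cost\<close>

definition phi :: "'a mtree \<Rightarrow> ('a \<times> 'b) set \<Rightarrow> 'a \<Rightarrow> 'a" where
  "phi T C x =
     (let S = {v \<in> verts T. tless T x v \<and> (\<exists>v'\<in>fst ` C. tle T v' v)}
      in THE v. v \<in> S \<and> (\<forall>u\<in>S. tle T v u))"

definition eta :: "'a mtree \<Rightarrow> 'b mtree \<Rightarrow> ('a \<times> 'b) set \<Rightarrow> 'a \<Rightarrow> 'b" where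
  "eta T G C x = arg_min_on (height G) {w. \<exists>v. (v, w) \<in> C \<and> tle T v (phi T C x)}"

definition chi :: "'a mtree \<Rightarrow> 'b mtree \<Rightarrow> ('a \<times> 'b) set \<Rightarrow> 'a \<Rightarrow> 'b" where
  "chi T G C x = LCA G {w. \<exists>v. (v, w) \<in> C \<and> v \<in> Lambda T C x}"

definition vertex_map :: "'a mtree \<Rightarrow> 'b mtree \<Rightarrow> ('a \<times> 'b) set \<Rightarrow> 'a \<Rightarrow> 'b mpoint" where
  "vertex_map T G C x =
     (if x \<in> fst ` C then vpoint G (THE y. (x, y) \<in> C)
      else if x \<in> deleted T C \<and> card (Lambda T C x) = 0 then
        point_above G (vpoint G (eta T G C x))
          (max (height G (eta T G C x)) ((height T x + height T (phi T C x)) / 2))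
      else if x \<in> deleted T C \<and> card (Lambda T C x) > 1 then vpoint G (chi T G C x)
      else undefined)"

definition cost :: "'a mtree \<Rightarrow> 'b mtree \<Rightarrow> ('a \<times> 'b) set \<Rightarrow> real" where
  "cost T G C = max
     (Max ((\<lambda>x. \<bar>mheight (vertex_map T G C x) - height T x\<bar>) ` (verts T - unused T C)))
     (Max ((\<lambda>y. \<bar>mheight (vertex_map G T (C\<inverse>) y) - height G y\<bar>) ` (verts G - unused G (C\<inverse>))))"

text \<open>The minimum over couplings ranges over a finite nonempty set.\<close>

lemma finite_couplings:
  assumes "merge_tree T" "merge_tree G"
  shows "finite (couplings T G)"
proof (rule finite_subset)
  show "couplings T G \<subseteq> Pow (verts T \<times> verts G)"
    by (auto simp: couplings_def)
  show "finite (Pow (verts T \<times> verts G))"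
    using assms by (simp add: merge_tree.finite_verts)
qed

lemma couplings_nonempty:
  assumes "merge_tree T" "merge_tree G"
  shows "couplings T G \<noteq> {}"
proof -
  interpret T: merge_tree T by fact
  interpret G: merge_tree G by fact
  let ?C = "{(root T, root G)}"
  have T_irrefl: "\<not> tless T x x" for x using T.height_strict_mono[of x x] by auto
  have G_irrefl: "\<not> tless G x x" for x using G.height_strict_mono[of x x] by auto
  have LT: "Lambda T ?C (root T) = {}" using T_irrefl by (auto simp: Lambda_def)
  have LG: "Lambda G (?C\<inverse>) (root G) = {}" using G_irrefl by (auto simp: Lambda_def)
  have "{p \<in> ?C. \<not> (\<exists>q\<in>?C. pair_less T G p q)} = ?C"
    using T_irrefl by (auto simp: pair_less_def)
  then have "card {p \<in> ?C. \<not> (\<exists>q\<in>?C. pair_less T G p q)} = 1" by simp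
  then have "?C \<in> couplings T G"
    unfolding couplings_def mem_Collect_eq
    using LT LG T.root_in_verts G.root_in_verts T_irrefl G_irrefl
    by (intro conjI) auto
  then show ?thesis by blast
qed

end

theory Submission
  imports Defs
begin

text \<open>Let f and g be the heights on T and G, and let J(u, v) be the height of the least common ancestor of
two vertices; J is an ultrametric except that J(v, v) = f(v). Topology enters only once: the
shortest path metric is 2 J(x, y) - f(x) - f(y), with J(x, y) the height of the join of two points,
whence a map that raises all heights by a constant is continuous iff it is monotone
(\<open>continuous_map_mtop_if_mono\<close>, \<open>mono_if_continuous_map_mtop\<close>). Everything
else is about monotone maps.

A coupling C of cost \<epsilon> gives \<epsilon>-compatible maps. A point x above a coupled vertex v
goes to the point at height f(x) + \<epsilon> above the partner w of v. The choice of v does not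
matter, because the partners of two vertices below a have a common ancestor of height at most f(a) +
\<epsilon> (\<open>partners_merge\<close>). A point above no coupled vertex goes above \<eta>. The
way back from above w ends above v, at height f(x) + 2\<epsilon>, and that is above x too
(\<open>coupling_map_coupling_map\<close>).

Conversely, let \<epsilon>-compatible maps \<alpha> and \<beta> be given. A matching is a set of
pairs (v, w) with |J(v, v') - J(w, w')| \<le> \<epsilon> for any two of its pairs, equal or not,
which is an antichain on both sides. A nonempty set of pairs is a common cluster if it consists of
all the pairs below some vertex of T, and also of all the pairs below some vertex of G; coupling the
two least common ancestors of each common cluster gives a coupling. Its cost is at most \<epsilon>
as soon as every vertex x of T has, among the v which merge with x first, one with J(x, v) \<le>
f(x) + 2\<epsilon> and g(w) \<le> f(x) + \<epsilon>, and symmetrically for G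
(\<open>nearest_cheap\<close>, \<open>cost_cluster_coupling\<close>).

A first matching consists of the v with a minimal image \<alpha>(v), each paired with the vertex
just below \<alpha>(v). It satisfies a weaker condition (\<open>covering\<close>): J(x, v) \<le>
f(x) + 2\<epsilon> for some v no higher than x, which need not be one that merges with x first, and
J(y, w) \<le> g(y) + 2\<epsilon> for some pair with f(v) \<le> g(y) + \<epsilon>. Among all covering
matchings take one with the least total height of the w, each height being measured from a level
below G. If some x or y violated the stronger condition, an offending pair (v, w) could be dropped,
or w could be replaced by a lower vertex and some further pairs dropped, without losing the covering
condition (\<open>drop_pair_W\<close>, \<open>improve_pair_V\<close>), which contradicts minimality.
Hence this matching yields a coupling of cost at most \<epsilon>.\<close>

section \<open>Ancestors and least common ancestors\<close>

lemma ex_minimizer: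
  fixes f :: "'c \<Rightarrow> real"
  assumes "finite S" "S \<noteq> {}"
  shows "\<exists>x\<in>S. \<forall>y\<in>S. f x \<le> f y"
  using arg_min_if_finite(1)[OF assms] arg_min_least[OF assms] by blast

context merge_tree
begin

lemma tle_height: "tle T x y \<Longrightarrow> height T x \<le> height T y"
  using height_strict_mono by (fastforce simp: rtrancl_eq_or_trancl)

lemma tle_eqI: "tle T x y \<Longrightarrow> height T y \<le> height T x \<Longrightarrow> x = y"
  using height_strict_mono by (fastforce simp: rtrancl_eq_or_trancl)

lemma tless_iff: "tless T x y \<longleftrightarrow> tle T x y \<and> x \<noteq> y"
  using height_strict_mono by (fastforce simp: rtrancl_eq_or_trancl)

lemma father_unique: "(v, p) \<in> edges T \<Longrightarrow> (v, q) \<in> edges T \<Longrightarrow> p = q"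
  using edges_subset root_no_father unique_father by blast

text \<open>The ancestors of a vertex form a chain, since every vertex has at most one father.\<close>

lemma tle_chain:
  assumes "tle T x a" "tle T x b" "height T a \<le> height T b"
  shows "tle T a b"
proof -
  have "single_valued (edges T)"
    using father_unique by (auto simp: single_valued_def)
  then have "tle T a b \<or> tle T b a"
    using assms single_valued_confluent by metis
  then show ?thesis
    using tle_eqI[of b a] assms(3) by auto
qed

lemma tle_verts: "tle T x y \<Longrightarrow> x \<in> verts T \<Longrightarrow> y \<in> verts T"
  by (induction rule: rtrancl_induct) (use edges_subset in auto)

lemma tless_father:
  assumes "tless T v a" "(v, p) \<in> edges T"
  shows "tle T p a"
proof -
  obtain q where "(v, q) \<in> edges T" "tle T q a"
    using assms(1) by (meson tranclD)
  then show ?thesis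
    using assms(2) father_unique by blast
qed

lemma is_lub_unique: "is_lub T A u \<Longrightarrow> is_lub T A v \<Longrightarrow> u = v"
  unfolding is_lub_def by (meson tle_eqI tle_height)

lemma LCA_eqI: "is_lub T A u \<Longrightarrow> LCA T A = u"
  unfolding LCA_def using is_lub_unique by blast

lemma is_lub_LCA:
  assumes "A \<subseteq> verts T" "A \<noteq> {}"
  shows "is_lub T A (LCA T A)"
proof -
  define U where "U = {u \<in> verts T. \<forall>a\<in>A. tle T a u}"
  have fin: "finite U"
    using finite_verts by (simp add: U_def)
  have "root T \<in> U"
    using assms(1) root_in_verts below_root by (auto simp: U_def)
  then have ne: "U \<noteq> {}" by auto
  obtain u where u: "u \<in> U" "\<And>w. w \<in> U \<Longrightarrow> height T u \<le> height T w"
    using ex_minimizer[OF fin ne, of "height T"] by blast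
  obtain a where "a \<in> A" using assms(2) by auto
  then have "is_lub T A u"
    using u tle_chain[of a u] unfolding is_lub_def U_def by blast
  then show ?thesis using LCA_eqI by simp
qed

lemma LCA_in_verts: "A \<subseteq> verts T \<Longrightarrow> A \<noteq> {} \<Longrightarrow> LCA T A \<in> verts T"
  and LCA_upper: "A \<subseteq> verts T \<Longrightarrow> a \<in> A \<Longrightarrow> tle T a (LCA T A)"
  and LCA_least: "A \<subseteq> verts T \<Longrightarrow> A \<noteq> {} \<Longrightarrow> u \<in> verts T \<Longrightarrow> (\<And>a. a \<in> A \<Longrightarrow> tle T a u) \<Longrightarrow> tle T (LCA T A) u"
  using is_lub_LCA[of A] by (auto simp: is_lub_def)

lemma LCA_singleton: "v \<in> verts T \<Longrightarrow> LCA T {v} = v"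
  by (rule LCA_eqI) (auto simp: is_lub_def)

end

definition merge_height :: "'a mtree \<Rightarrow> 'a \<Rightarrow> 'a \<Rightarrow> real" where
  "merge_height T u v = height T (LCA T {u, v})"

context merge_tree
begin

lemma merge_height_commute: "merge_height T u v = merge_height T v u"
  by (simp add: merge_height_def insert_commute)

lemma merge_height_self: "v \<in> verts T \<Longrightarrow> merge_height T v v = height T v"
  by (simp add: merge_height_def LCA_singleton)

lemma merge_height_ge: "u \<in> verts T \<Longrightarrow> v \<in> verts T \<Longrightarrow> height T u \<le> merge_height T u v"
  unfolding merge_height_def by (rule tle_height, rule LCA_upper) auto

lemma merge_height_le:
  "u \<in> verts T \<Longrightarrow> v \<in> verts T \<Longrightarrow> tle T u a \<Longrightarrow> tle T v a \<Longrightarrow> merge_height T u v \<le> height T a"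
  unfolding merge_height_def
  by (rule tle_height, rule LCA_least) (auto intro: tle_verts)

text \<open>The height of an ancestor of \<open>u\<close> decides whether it is also above \<open>v\<close>. Together with the previous
  lemma, this replaces the order on the tree by inequalities between numbers.\<close>

lemma tle_of_merge_height:
  assumes "u \<in> verts T" "v \<in> verts T" "tle T u a" "merge_height T u v \<le> height T a"
  shows "tle T v a"
proof -
  have "tle T (LCA T {u, v}) a"
    using tle_chain[of u "LCA T {u, v}" a] assms LCA_upper[of "{u, v}" u]
    by (auto simp: merge_height_def)
  moreover have "tle T v (LCA T {u, v})"
    using assms LCA_upper[of "{u, v}" v] by auto
  ultimately show ?thesis by simp
qed

lemma merge_height_ultra:
  assumes "x \<in> verts T" "y \<in> verts T" "z \<in> verts T"
  shows "merge_height T x z \<le> max (merge_height T x y) (merge_height T y z)"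
proof -
  define a b where "a = LCA T {x, y}" and "b = LCA T {y, z}"
  have a: "tle T x a" "tle T y a" and b: "tle T y b" "tle T z b"
    unfolding a_def b_def using assms by (auto intro!: LCA_upper)
  show ?thesis
  proof (cases "height T a \<le> height T b")
    case True
    then have "tle T a b" using tle_chain a b by blast
    then have "merge_height T x z \<le> height T b"
      using assms a b by (intro merge_height_le) auto
    then show ?thesis by (simp add: b_def merge_height_def)
  next
    case False
    then have "tle T b a" using tle_chain[of y b a] a b by auto
    then have "merge_height T x z \<le> height T a"
      using assms a b by (intro merge_height_le) auto
    then show ?thesis by (simp add: a_def merge_height_def)
  qed
qed

text \<open>The least common ancestors of a fixed \<open>a\<close> with the elements of \<open>A\<close> form a chain, so the highest of
  them is above all of \<open>A\<close>. Bounds on pairs therefore extend to sets.\<close>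

lemma height_LCA_le_pair:
  assumes "A \<subseteq> verts T" "a \<in> A"
  obtains b where "b \<in> A" "height T (LCA T A) \<le> merge_height T a b"
proof -
  have fin: "finite A" using assms finite_verts finite_subset by blast
  define M where "M = Max (merge_height T a ` A)"
  have "M \<in> merge_height T a ` A"
    using fin assms unfolding M_def by (intro Max_in) auto
  then obtain b where b: "b \<in> A" "M = merge_height T a b" by auto
  have max: "merge_height T a c \<le> M" if "c \<in> A" for c
    using fin that unfolding M_def by auto
  have "tle T c (LCA T {a, b})" if "c \<in> A" for c
  proof (rule tle_of_merge_height[of a])
    show "merge_height T a c \<le> height T (LCA T {a, b})"
      using max[OF that] b by (simp add: merge_height_def)
    show "tle T a (LCA T {a, b})" using assms b by (intro LCA_upper) auto
  qed (use assms that in auto)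
  then have "tle T (LCA T A) (LCA T {a, b})"
    using assms b by (intro LCA_least LCA_in_verts) auto
  then show ?thesis
    using that[OF b(1)] tle_height by (simp add: merge_height_def)
qed

section \<open>Points of the metric tree\<close>

lemma mpointD: "x \<in> mpoints T \<Longrightarrow> fst x \<in> verts T \<and> height T (fst x) \<le> mheight x"
  by (auto simp: mpoints_def mheight_def)

lemma mpoint_below_father: "x \<in> mpoints T \<Longrightarrow> (fst x, p) \<in> edges T \<Longrightarrow> mheight x < height T p"
  by (auto simp: mpoints_def mheight_def)

lemma mpoint_below_ancestor: "x \<in> mpoints T \<Longrightarrow> tless T (fst x) a \<Longrightarrow> mheight x < height T a"
  by (metis mpoint_below_father tless_father tle_height tranclD less_le_trans)

lemma mheight_vpoint [simp]: "mheight (vpoint T v) = height T v"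
  and fst_vpoint [simp]: "fst (vpoint T v) = v"
  by (simp_all add: mheight_def vpoint_def)

lemma vpoint_in [simp]: "v \<in> verts T \<Longrightarrow> vpoint T v \<in> mpoints T"
  using height_strict_mono by (auto simp: mpoints_def vpoint_def)

lemma mle_refl [simp]: "mle T x x \<longleftrightarrow> x \<in> mpoints T"
  by (auto simp: mle_def)

lemma mle_trans: "mle T x y \<Longrightarrow> mle T y z \<Longrightarrow> mle T x z"
  by (auto simp: mle_def)

lemma mle_mheight: "mle T x y \<Longrightarrow> mheight x \<le> mheight y"
  and mle_in1: "mle T x y \<Longrightarrow> x \<in> mpoints T"
  and mle_in2: "mle T x y \<Longrightarrow> y \<in> mpoints T"
  by (auto simp: mle_def)

lemma mle_eqI:
  assumes "mle T x y" "mheight y \<le> mheight x"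
  shows "x = y"
proof -
  have "fst x = fst y"
    using assms mpoint_below_ancestor[of x "fst y"] mpointD[of y]
    by (auto simp: mle_def tless_iff)
  then show ?thesis
    using assms by (auto simp: mle_def mheight_def prod_eq_iff)
qed

lemma mle_vpoint_iff: "v \<in> verts T \<Longrightarrow> x \<in> mpoints T \<Longrightarrow> mle T (vpoint T v) x \<longleftrightarrow> tle T v (fst x)"
  using mpointD[of x] tle_height[of v "fst x"] by (auto simp: mle_def)

lemma mle_vpoint_fst: "x \<in> mpoints T \<Longrightarrow> mle T (vpoint T (fst x)) x"
  using mpointD[of x] mle_vpoint_iff by auto

lemma mle_chain:
  assumes "mle T x y" "mle T x z" "mheight y \<le> mheight z"
  shows "mle T y z"
proof (cases "height T (fst y) \<le> height T (fst z)")
  case True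
  then show ?thesis
    using assms tle_chain[of "fst x" "fst y" "fst z"] by (auto simp: mle_def)
next
  case False
  then have "tless T (fst z) (fst y)"
    using assms tle_chain[of "fst x" "fst z" "fst y"] by (auto simp: mle_def tless_iff)
  then have "mheight z < height T (fst y)"
    using assms mpoint_below_ancestor by (auto simp: mle_def)
  then show ?thesis
    using assms mpointD[of y] by (auto simp: mle_def)
qed

lemma ex_point_above:
  assumes "x \<in> mpoints T" "mheight x \<le> h"
  shows "\<exists>y. mle T x y \<and> mheight y = h"
proof -
  \<comment> \<open>The point lies on the edge that starts at the highest ancestor of height at most \<open>h\<close>.\<close>
  define A where "A = {u \<in> verts T. tle T (fst x) u \<and> height T u \<le> h}"
  have fin: "finite A" using finite_verts by (simp add: A_def)
  have x: "fst x \<in> verts T" "height T (fst x) \<le> mheight x" using assms mpointD by auto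
  have "fst x \<in> A" using x assms by (auto simp: A_def)
  then have ne: "A \<noteq> {}" by auto
  have "Max (height T ` A) \<in> height T ` A" using fin ne by (intro Max_in) auto
  then obtain u where u: "u \<in> A" "Max (height T ` A) = height T u" by auto
  then have max: "height T w \<le> height T u" if "w \<in> A" for w
    using fin that by (metis Max_ge finite_imageI imageI)
  have "h < height T p" if "(u, p) \<in> edges T" for p
  proof (rule ccontr)
    assume "\<not> h < height T p"
    then have "p \<in> A"
      using u that edges_subset by (auto simp: A_def intro: rtrancl_into_rtrancl)
    moreover have "height T u < height T p"
      using that height_strict_mono by blast
    ultimately show False using max by fastforce
  qed
  then have "mle T x (u, h)"
    using u assms x by (auto simp: A_def mle_def mpoints_def mheight_def)
  then show ?thesis by (auto simp: mheight_def)
qed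

lemma point_above_eqI:
  assumes "mle T x y" "mheight y = h"
  shows "point_above T x h = y"
  unfolding point_above_def
proof (rule the_equality)
  fix z assume "mle T x z \<and> mheight z = h"
  then show "z = y"
    using assms mle_chain[of x z y] by (intro mle_eqI) auto
qed (use assms in simp)

lemma mle_point_above: "x \<in> mpoints T \<Longrightarrow> mheight x \<le> h \<Longrightarrow> mle T x (point_above T x h)"
  and mheight_point_above: "x \<in> mpoints T \<Longrightarrow> mheight x \<le> h \<Longrightarrow> mheight (point_above T x h) = h"
  using ex_point_above point_above_eqI by metis+

lemma point_above_in: "x \<in> mpoints T \<Longrightarrow> mheight x \<le> h \<Longrightarrow> point_above T x h \<in> mpoints T"
  using mle_point_above mle_in2 by blast

lemma point_above_mono:
  assumes "mle T x y" "mheight y \<le> h"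
  shows "point_above T y h = point_above T x h"
proof -
  have "mheight x \<le> mheight y" "y \<in> mpoints T" using assms by (auto simp: mle_def)
  then show ?thesis
    using assms by (metis mle_point_above mheight_point_above mle_trans point_above_eqI)
qed

text \<open>The join is the higher of the two points if they are comparable, and otherwise the least common
  ancestor of their lower vertices.\<close>

lemma join_point:
  assumes "x \<in> mpoints T" "y \<in> mpoints T"
  obtains z where "mle T x z" "mle T y z" "\<And>z'. mle T x z' \<Longrightarrow> mle T y z' \<Longrightarrow> mle T z z'"
    "mle T x y \<or> mle T y x \<or> z = vpoint T (LCA T {fst x, fst y})"
proof (cases "mle T x y \<or> mle T y x")
  case True
  then show ?thesis using that assms by (metis mle_refl)
next
  case False
  define a where "a = LCA T {fst x, fst y}"
  have v: "fst x \<in> verts T" "fst y \<in> verts T" using assms mpointD by auto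
  then have a: "a \<in> verts T" "tle T (fst x) a" "tle T (fst y) a"
    unfolding a_def by (auto intro!: LCA_in_verts LCA_upper)
  have ne: "fst y \<noteq> fst x"
    using False assms by (auto simp: mle_def)
  have "a \<noteq> fst x"
    using False a assms ne mpoint_below_ancestor[of y "fst x"] mpointD[of x]
    by (auto simp: mle_def tless_iff)
  moreover have "a \<noteq> fst y"
    using False a assms ne[symmetric] mpoint_below_ancestor[of x "fst y"] mpointD[of y]
    by (auto simp: mle_def tless_iff)
  ultimately have "mle T x (vpoint T a)" "mle T y (vpoint T a)"
    using a assms mpoint_below_ancestor[of _ a] by (auto simp: mle_def tless_iff less_imp_le)
  moreover have "mle T (vpoint T a) z'" if "mle T x z'" "mle T y z'" for z'
    using that a v mpointD[of z'] unfolding a_def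
    by (subst mle_vpoint_iff) (auto simp: mle_def intro!: LCA_least)
  ultimately show ?thesis using that a_def by blast
qed

end

section \<open>The shortest path metric\<close>

definition join_height :: "'a mtree \<Rightarrow> 'a mpoint \<Rightarrow> 'a mpoint \<Rightarrow> real" where
  "join_height T x y = Inf (mheight ` {z. mle T x z \<and> mle T y z})"

definition tree_dist :: "'a mtree \<Rightarrow> 'a mpoint \<Rightarrow> 'a mpoint \<Rightarrow> real" where
  "tree_dist T x y = 2 * join_height T x y - mheight x - mheight y"

context merge_tree
begin

lemma join_heightE:
  assumes "x \<in> mpoints T" "y \<in> mpoints T"
  obtains z where "mle T x z" "mle T y z" "mheight z = join_height T x y"
    "\<And>z'. mle T x z' \<Longrightarrow> mle T y z' \<Longrightarrow> mle T z z'"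
    "mle T x y \<or> mle T y x \<or> z = vpoint T (LCA T {fst x, fst y})"
proof -
  obtain z where z: "mle T x z" "mle T y z" "\<And>z'. mle T x z' \<Longrightarrow> mle T y z' \<Longrightarrow> mle T z z'"
    "mle T x y \<or> mle T y x \<or> z = vpoint T (LCA T {fst x, fst y})"
    using join_point[OF assms] by blast
  have "join_height T x y = mheight z"
    unfolding join_height_def
    by (rule cInf_eq_minimum) (use z in \<open>auto intro: mle_mheight\<close>)
  then show ?thesis using z that by metis
qed

lemma join_height_le:
  assumes "mle T x z" "mle T y z"
  shows "join_height T x y \<le> mheight z"
  by (metis assms join_heightE mle_in1 mle_mheight)

lemma join_height_commute: "join_height T x y = join_height T y x"
  unfolding join_height_def by (simp add: conj_commute)

lemma join_height_ge:
  assumes "x \<in> mpoints T" "y \<in> mpoints T"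
  shows "mheight x \<le> join_height T x y" "mheight y \<le> join_height T x y"
  by (metis assms join_heightE mle_mheight)+

lemma join_height_eq: "mle T x y \<Longrightarrow> join_height T x y = mheight y"
  by (metis antisym join_height_ge(2) join_height_le mle_in1 mle_in2 mle_refl)

lemma tree_dist_triangle:
  assumes "x \<in> mpoints T" "y \<in> mpoints T" "z \<in> mpoints T"
  shows "tree_dist T x z \<le> tree_dist T x y + tree_dist T y z"
proof -
  obtain a where a: "mle T x a" "mle T y a" "mheight a = join_height T x y"
    using join_heightE assms by metis
  obtain b where b: "mle T y b" "mle T z b" "mheight b = join_height T y z"
    using join_heightE assms by metis
  have "join_height T x z \<le> max (mheight a) (mheight b)"
  proof (cases "mheight a \<le> mheight b")
    case True
    then have "mle T x b" using mle_chain a b mle_trans by blast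
    then show ?thesis using join_height_le b by fastforce
  next
    case False
    then have "mle T z a" using mle_chain[of y b a] a b mle_trans[of z b a] by auto
    then show ?thesis using join_height_le a by fastforce
  qed
  moreover have "mheight y \<le> mheight a" "mheight y \<le> mheight b"
    using mle_mheight[OF a(2)] mle_mheight[OF b(1)] by auto
  ultimately show ?thesis
    using a b by (auto simp: tree_dist_def max_def split: if_splits)
qed

lemma tree_dist_comparable: "mle T x y \<or> mle T y x \<Longrightarrow> tree_dist T x y = \<bar>mheight x - mheight y\<bar>"
  using join_height_eq[of x y] join_height_eq[of y x] join_height_commute[of x y]
    mle_mheight[of x y] mle_mheight[of y x]
  by (auto simp: tree_dist_def)

lemma mseg_above:
  assumes "p \<in> mseg T v"
  shows "mle T (vpoint T v) p"
proof (cases "p \<in> mpoints T \<and> fst p = v")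
  case True
  then show ?thesis using mle_vpoint_fst[of p] by auto
next
  case False
  then obtain q where q: "p = vpoint T q" "(v, q) \<in> edges T"
    using assms by (auto simp: mseg_def)
  then have "v \<in> verts T" "q \<in> verts T" using edges_subset by auto
  then show ?thesis using q mle_vpoint_iff by auto
qed

lemma mseg_comparable: "p \<in> mseg T v \<Longrightarrow> q \<in> mseg T v \<Longrightarrow> mle T p q \<or> mle T q p"
  using mle_chain mseg_above by (meson linear)

lemma chain_length_singleton [simp]: "chain_length [p] = 0"
  and chain_length_Cons [simp]: "chain_length (p # q # ps) = \<bar>mheight p - mheight q\<bar> + chain_length (q # ps)"
  by (simp_all add: chain_length_def)

lemma tree_dist_le_chain_length:
  "mchain T x y ps \<Longrightarrow> x \<in> mpoints T \<Longrightarrow> y \<in> mpoints T \<and> tree_dist T x y \<le> chain_length ps"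
proof (induction ps arbitrary: x)
  case Nil
  then show ?case by (simp add: mchain_def)
next
  case (Cons p ps)
  show ?case
  proof (cases ps)
    case Nil
    then show ?thesis using Cons.prems by (auto simp: mchain_def tree_dist_comparable)
  next
    case [simp]: (Cons q qs)
    have [simp]: "p = x" using Cons.prems by (simp add: mchain_def)
    obtain v where v: "x \<in> mseg T v" "q \<in> mseg T v"
      using Cons.prems by (auto simp: mchain_def)
    have q: "q \<in> mpoints T" using mseg_above[OF v(2)] mle_in2 by blast
    have "mchain T q y ps"
      using Cons.prems by (auto simp: mchain_def)
    then have "y \<in> mpoints T" "tree_dist T q y \<le> chain_length ps"
      using Cons.IH q by auto
    moreover have "tree_dist T x q = \<bar>mheight x - mheight q\<bar>"
      using mseg_comparable v tree_dist_comparable by blast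
    ultimately show ?thesis
      using tree_dist_triangle[of x q y] q Cons.prems by auto
  qed
qed

lemma mchain_Cons:
  assumes "p \<in> mseg T v" "q \<in> mseg T v" "v \<in> verts T" "mchain T q y ps"
  shows "mchain T p y (p # ps)" "chain_length (p # ps) = \<bar>mheight p - mheight q\<bar> + chain_length ps"
  using assms by (cases ps; auto simp: mchain_def)+

lemma mchain_down:
  assumes "y \<in> mpoints T" "tle T (fst y) u" "z \<in> mseg T u" "mheight y \<le> mheight z"
  shows "\<exists>ps. mchain T z y ps \<and> chain_length ps = mheight z - mheight y"
  using assms(2-4)
proof (induction arbitrary: z rule: rtrancl_induct)
  case base
  have "y \<in> mseg T (fst y)" "mchain T y y [y]" using assms(1) by (auto simp: mseg_def mchain_def)
  then show ?case
    using base assms mchain_Cons[of z "fst y" y y "[y]"] mpointD by (intro exI[of _ "[z, y]"]) auto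
next
  case (step v' v)
  have v: "v' \<in> verts T" "v \<in> verts T" using step edges_subset by auto
  have vp: "vpoint T v \<in> mseg T v'" "vpoint T v \<in> mseg T v"
    using step v by (auto simp: mseg_def)
  have "tless T (fst y) v" using step by auto
  then have "mheight y \<le> mheight (vpoint T v)"
    using mpoint_below_ancestor[OF assms(1)] by fastforce
  then obtain ps where "mchain T (vpoint T v) y ps" "chain_length ps = mheight (vpoint T v) - mheight y"
    using step.IH vp by blast
  moreover have "mheight (vpoint T v) \<le> mheight z"
    using mseg_above step.prems mle_mheight by blast
  ultimately show ?case
    using mchain_Cons[of z v "vpoint T v" y ps] step.prems vp v
    by (intro exI[of _ "z # ps"]) auto
qed

lemma mchain_up:
  assumes "z \<in> mpoints T" "tle T v (fst z)" "x \<in> mpoints T" "fst x = v" "mheight x \<le> mheight z"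
    "mchain T z y ps"
  shows "\<exists>qs. mchain T x y qs \<and> chain_length qs = mheight z - mheight x + chain_length ps"
  using assms(2-5)
proof (induction arbitrary: x rule: converse_rtrancl_induct)
  case base
  then have "x \<in> mseg T (fst z)" "z \<in> mseg T (fst z)" using assms(1) by (auto simp: mseg_def)
  then show ?case
    using base assms mchain_Cons[of x "fst z" z y ps] mpointD by (intro exI[of _ "x # ps"]) auto
next
  case (step v v')
  have v: "v' \<in> verts T" "v \<in> verts T" using step edges_subset by auto
  have vp: "vpoint T v' \<in> mseg T v" "x \<in> mseg T v" "vpoint T v' \<in> mpoints T"
    using step v by (auto simp: mseg_def)
  have "mheight (vpoint T v') \<le> mheight z"
    using step(2) assms(1) v mle_vpoint_iff mle_mheight by blast
  then obtain qs where "mchain T (vpoint T v') y qs"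
      "chain_length qs = mheight z - mheight (vpoint T v') + chain_length ps"
    using step.IH[of "vpoint T v'"] vp by auto
  moreover have "mheight x \<le> mheight (vpoint T v')"
    using mpoint_below_father[of x v'] step by auto
  ultimately show ?case
    using mchain_Cons[of x v "vpoint T v'" y qs] vp v
    by (intro exI[of _ "x # qs"]) auto
qed

text \<open>A chain of points is never shorter than the path through the join, because the joins satisfy the
  ultrametric inequality; and that path is itself the union of finitely many segments.\<close>

theorem mdist_eq_tree_dist:
  assumes "x \<in> mpoints T" "y \<in> mpoints T"
  shows "mdist T x y = tree_dist T x y"
proof -
  obtain z where z: "mle T x z" "mle T y z" "mheight z = join_height T x y"
    using join_heightE assms by metis
  have zm: "z \<in> mpoints T" "z \<in> mseg T (fst z)" using z by (auto simp: mle_def mseg_def)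
  obtain ps where ps: "mchain T z y ps" "chain_length ps = mheight z - mheight y"
    using mchain_down[of y "fst z" z] z(2) zm by (auto simp: mle_def)
  obtain qs where "mchain T x y qs" "chain_length qs = mheight z - mheight x + chain_length ps"
    using mchain_up[of z "fst x" x y ps] z(1) zm(1) ps(1) assms(1) mle_mheight[OF z(1)]
    by (auto simp: mle_def)
  then have "mchain T x y qs" "chain_length qs = tree_dist T x y"
    using z ps by (auto simp: tree_dist_def)
  then have "Inf (chain_length ` {ps. mchain T x y ps}) = tree_dist T x y"
    using tree_dist_le_chain_length[OF _ assms(1), of y]
    by (intro cInf_eq_minimum) (auto simp: image_iff intro!: exI[of _ qs])
  then show ?thesis using assms by (simp add: mdist_def)
qed

lemma Metric_space_mdist: "Metric_space (mpoints T) (mdist T)"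
proof
  show "0 \<le> mdist T x y" for x y
    using join_height_ge[of x y] mdist_eq_tree_dist[of x y]
    by (cases "x \<in> mpoints T \<and> y \<in> mpoints T") (auto simp: tree_dist_def mdist_def)
  show "mdist T x y = mdist T y x" for x y
    using mdist_eq_tree_dist[of x y] mdist_eq_tree_dist[of y x] join_height_commute[of x y]
    by (cases "x \<in> mpoints T \<and> y \<in> mpoints T") (auto simp: tree_dist_def mdist_def)
  show "mdist T x y = 0 \<longleftrightarrow> x = y" if xy: "x \<in> mpoints T" "y \<in> mpoints T" for x y
  proof -
    obtain z where z: "mle T x z" "mle T y z" "mheight z = join_height T x y"
      using join_heightE xy by metis
    have "x = y" if "tree_dist T x y = 0"
    proof -
      have "mheight z \<le> mheight x" "mheight z \<le> mheight y"
        using that z(3) mle_mheight[OF z(1)] mle_mheight[OF z(2)] unfolding tree_dist_def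
        by linarith+
      then show ?thesis using mle_eqI[OF z(1)] mle_eqI[OF z(2)] by simp
    qed
    then show ?thesis
      using xy mdist_eq_tree_dist tree_dist_comparable[of x x] by auto
  qed
  show "mdist T x z \<le> mdist T x y + mdist T y z"
    if "x \<in> mpoints T" "y \<in> mpoints T" "z \<in> mpoints T" for x y z
    using that tree_dist_triangle mdist_eq_tree_dist by metis
qed

text \<open>A point can only be incomparable to \<open>x\<close> if the path joining them passes through the father of
  the edge of \<open>x\<close>.\<close>

lemma comparable_if_close:
  assumes "x \<in> mpoints T"
  shows "\<exists>r>0. \<forall>y\<in>mpoints T. tree_dist T x y < r \<longrightarrow> mle T x y \<or> mle T y x"
proof (cases "fst x = root T")
  case True
  have "mle T x y \<or> mle T y x" if y: "y \<in> mpoints T" for y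
  proof -
    have "mle T (vpoint T (fst y)) x"
      using True y mpointD assms below_root by (subst mle_vpoint_iff) auto
    then show ?thesis
      using mle_chain mle_vpoint_fst[OF y] by (meson linear)
  qed
  then show ?thesis by (intro exI[of _ 1]) auto
next
  case False
  then obtain p where p: "(fst x, p) \<in> edges T"
    using unique_father mpointD assms by blast
  have "mle T x y \<or> mle T y x" if y: "y \<in> mpoints T" "tree_dist T x y < height T p - mheight x" for y
  proof (rule ccontr)
    assume inc: "\<not> (mle T x y \<or> mle T y x)"
    obtain z where z: "mle T x z" "mle T y z" "mheight z = join_height T x y"
      "z = vpoint T (LCA T {fst x, fst y})"
      using join_heightE[OF assms y(1)] inc by metis
    have "x \<noteq> z" using z inc by auto
    then have "mheight x < mheight z" using mle_eqI[OF z(1)] by force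
    then have "z \<noteq> vpoint T (fst x)"
      using mpointD[OF assms] by auto
    then have "tless T (fst x) (fst z)"
      using z by (auto simp: tless_iff mle_def)
    then have "height T p \<le> mheight z"
      using tless_father[OF _ p] tle_height z(4) by fastforce
    then show False
      using y z mle_mheight[of y z] by (simp add: tree_dist_def)
  qed
  then show ?thesis
    using mpoint_below_father[OF assms p] by (intro exI[of _ "height T p - mheight x"]) auto
qed

end

text \<open>A monotone map which raises all heights by a constant carries the join of two points above both
  images, so it does not increase distances.\<close>

lemma continuous_map_mtop_if_mono:
  assumes "merge_tree T" "merge_tree G"
    and maps: "\<alpha> \<in> mpoints T \<rightarrow> mpoints G"
    and height: "\<And>x. x \<in> mpoints T \<Longrightarrow> mheight (\<alpha> x) = mheight x + \<epsilon>"
    and mono: "\<And>x y. mle T x y \<Longrightarrow> mle G (\<alpha> x) (\<alpha> y)"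
  shows "continuous_map (mtop T) (mtop G) \<alpha>"
proof -
  interpret T: merge_tree T by fact
  interpret G: merge_tree G by fact
  have lip: "mdist G (\<alpha> x) (\<alpha> y) \<le> mdist T x y" if xy: "x \<in> mpoints T" "y \<in> mpoints T" for x y
  proof -
    obtain z where z: "mle T x z" "mle T y z" "mheight z = join_height T x y"
      using T.join_heightE xy by metis
    have "join_height G (\<alpha> x) (\<alpha> y) \<le> mheight (\<alpha> z)"
      using z mono by (intro G.join_height_le) auto
    also have "\<dots> = join_height T x y + \<epsilon>"
      using height z T.mle_in2 by auto
    finally have "tree_dist G (\<alpha> x) (\<alpha> y) \<le> tree_dist T x y"
      using height xy by (auto simp: tree_dist_def)
    then show ?thesis
      using xy maps by (simp add: T.mdist_eq_tree_dist G.mdist_eq_tree_dist Pi_iff)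
  qed
  show ?thesis
    unfolding mtop_def Metric_space.metric_continuous_map[OF T.Metric_space_mdist G.Metric_space_mdist]
  proof (intro conjI ballI allI impI)
    show "\<alpha> ` mpoints T \<subseteq> mpoints G" using maps by auto
    fix a and r :: real
    assume "a \<in> mpoints T" "0 < r"
    then show "\<exists>\<delta>>0. \<forall>x. x \<in> mpoints T \<and> mdist T a x < \<delta> \<longrightarrow> mdist G (\<alpha> a) (\<alpha> x) < r"
      using lip by (meson le_less_trans)
  qed
qed

lemma mono_if_continuous_map_mtop:
  assumes "merge_tree T" "merge_tree G"
    and cont: "continuous_map (mtop T) (mtop G) \<alpha>"
    and height: "\<And>x. x \<in> mpoints T \<Longrightarrow> mheight (\<alpha> x) = mheight x + \<epsilon>"
    and le: "mle T x y"
  shows "mle G (\<alpha> x) (\<alpha> y)"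
proof -
  interpret T: merge_tree T by fact
  interpret G: merge_tree G by fact
  have maps: "\<alpha> u \<in> mpoints G" if "u \<in> mpoints T" for u
    using cont that unfolding mtop_def
      Metric_space.metric_continuous_map[OF T.Metric_space_mdist G.Metric_space_mdist] by blast
  have near: "\<exists>\<delta>>0. \<forall>v. v \<in> mpoints T \<and> mdist T u v < \<delta> \<longrightarrow> mdist G (\<alpha> u) (\<alpha> v) < r"
    if "u \<in> mpoints T" "r > 0" for u r
    using cont that unfolding mtop_def
      Metric_space.metric_continuous_map[OF T.Metric_space_mdist G.Metric_space_mdist] by blast
  \<comment> \<open>Lift the image of each point between \<open>x\<close> and \<open>y\<close> to the height of the image of \<open>y\<close>. Close points
    have comparable images, hence equal lifts, so the lift is constant along the interval.\<close>
  define I where "I = {mheight x..mheight y}"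
  define K where "K = mheight y + \<epsilon>"
  define c where "c t = point_above T x t" for t
  define F where "F t = point_above G (\<alpha> (c t)) K" for t
  have x: "x \<in> mpoints T" and y: "y \<in> mpoints T" and xy: "mheight x \<le> mheight y"
    using le T.mle_in1 T.mle_in2 T.mle_mheight by auto
  have c: "mle T x (c t)" "mheight (c t) = t" "c t \<in> mpoints T" if "t \<in> I" for t
    using that x unfolding c_def I_def
    by (auto intro: T.mle_point_above T.mheight_point_above T.point_above_in)
  have "F constant_on I"
  proof (rule locally_constant_imp_constant)
    show "connected I" by (simp add: I_def)
    fix t assume t: "t \<in> I"
    obtain r where r: "r > 0" "\<And>z. z \<in> mpoints G \<Longrightarrow> tree_dist G (\<alpha> (c t)) z < r \<Longrightarrow>
        mle G (\<alpha> (c t)) z \<or> mle G z (\<alpha> (c t))"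
      using G.comparable_if_close[OF maps[OF c(3)[OF t]]] by blast
    obtain \<delta> where \<delta>: "\<delta> > 0"
      "\<And>v. v \<in> mpoints T \<Longrightarrow> mdist T (c t) v < \<delta> \<Longrightarrow> mdist G (\<alpha> (c t)) (\<alpha> v) < r"
      using near[OF c(3)[OF t] r(1)] by blast
    have "F s = F t" if s: "s \<in> I" "\<bar>t - s\<bar> < \<delta>" for s
    proof -
      have "mle T (c t) (c s) \<or> mle T (c s) (c t)"
        using T.mle_chain c(1)[OF s(1)] c(1)[OF t] by (meson linear)
      then have "mdist T (c t) (c s) = \<bar>t - s\<bar>"
        using T.tree_dist_comparable c s t T.mdist_eq_tree_dist by auto
      then have "tree_dist G (\<alpha> (c t)) (\<alpha> (c s)) < r"
        using \<delta>(2)[OF c(3)[OF s(1)]] s t c(3) maps by (simp add: G.mdist_eq_tree_dist)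
      then have "mle G (\<alpha> (c t)) (\<alpha> (c s)) \<or> mle G (\<alpha> (c s)) (\<alpha> (c t))"
        using r(2) maps c s by blast
      moreover have "mheight (\<alpha> (c t)) \<le> K" "mheight (\<alpha> (c s)) \<le> K"
        using height c t s by (auto simp: K_def I_def)
      ultimately show ?thesis
        unfolding F_def using G.point_above_mono by metis
    qed
    then have "\<forall>s\<in>I \<inter> ball t \<delta>. F s = F t" by (simp add: dist_real_def)
    moreover have "openin (top_of_set I) (I \<inter> ball t \<delta>)" "t \<in> I \<inter> ball t \<delta>"
      using t \<delta>(1) by (simp_all add: openin_open_Int)
    ultimately show "\<exists>U. openin (top_of_set I) U \<and> t \<in> U \<and> (\<forall>s\<in>U. F s = F t)"
      by blast
  qed
  moreover have "mheight x \<in> I" "mheight y \<in> I" using xy by (auto simp: I_def)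
  ultimately have "F (mheight x) = F (mheight y)" by (metis constant_on_def)
  moreover have "c (mheight x) = x" "c (mheight y) = y"
    using le x by (auto simp: c_def intro!: T.point_above_eqI)
  ultimately have eq: "point_above G (\<alpha> x) K = point_above G (\<alpha> y) K"
    by (simp add: F_def)
  have "point_above G (\<alpha> y) K = \<alpha> y"
    using height y maps by (intro G.point_above_eqI) (auto simp: K_def)
  moreover have "mle G (\<alpha> x) (point_above G (\<alpha> x) K)"
    using height x xy maps by (intro G.mle_point_above) (auto simp: K_def)
  ultimately show ?thesis using eq by simp
qed

section \<open>Vertices relative to a coupling\<close>

lemma couplings_converse:
  assumes "C \<in> couplings T G"
  shows "C\<inverse> \<in> couplings G T"
proof -
  have "(\<exists>q\<in>C\<inverse>. pair_less G T (b, a) q) \<longleftrightarrow> (\<exists>q\<in>C. pair_less T G (a, b) q)" for a b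
    unfolding Bex_def split_paired_Ex pair_less_def by auto
  then have eq: "{p \<in> C\<inverse>. \<not> (\<exists>q\<in>C\<inverse>. pair_less G T p q)} = {p \<in> C. \<not> (\<exists>q\<in>C. pair_less T G p q)}\<inverse>"
    by auto
  have fs: "fst ` C\<inverse> = snd ` C" "snd ` C\<inverse> = fst ` C"
    by force+
  have "inj_on fst C" "inj_on snd C"
    using assms by (simp_all add: couplings_def)
  then have "inj_on fst (C\<inverse>)" "inj_on snd (C\<inverse>)"
    by (force simp: inj_on_def)+
  then show ?thesis
    using assms unfolding couplings_def mem_Collect_eq eq card_inverse fs converse_converse
    by (intro conjI) (simp; fast)+
qed

context merge_tree
begin

lemma finite_Lambda: "fst ` C \<subseteq> verts T \<Longrightarrow> finite (Lambda T C x)"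
  by (rule finite_subset[OF _ finite_verts]) (auto simp: Lambda_def)

lemma ex_Lambda:
  assumes "fst ` C \<subseteq> verts T" "u \<in> fst ` C" "tless T u x"
  obtains v where "v \<in> Lambda T C x" "tle T u v"
proof -
  define A where "A = {v \<in> fst ` C. tle T u v \<and> tless T v x}"
  have fin: "finite A"
    by (rule finite_subset[OF _ finite_verts]) (use assms(1) in \<open>auto simp: A_def\<close>)
  have "u \<in> A" using assms by (auto simp: A_def)
  then obtain v where v: "v \<in> A" "\<And>w. w \<in> A \<Longrightarrow> height T w \<le> height T v"
    using ex_minimizer[OF fin, of "\<lambda>w. - height T w"] by auto
  have "\<not> tless T v w" if "w \<in> fst ` C" "tless T w x" for w
  proof
    assume vw: "tless T v w"
    then have "w \<in> A"
      using that v(1) rtrancl_trans[of u v _ w] by (auto simp: A_def tless_iff)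
    then show False using v(2) height_strict_mono[OF vw] by force
  qed
  then have "v \<in> Lambda T C x"
    using v(1) by (auto simp: A_def Lambda_def)
  then show ?thesis using v(1) that by (auto simp: A_def)
qed

lemma phi_eqI:
  assumes "x \<in> verts T" "tless T x p" "v \<in> fst ` C" "tle T v p"
    and least: "\<And>u v. tless T x u \<Longrightarrow> v \<in> fst ` C \<Longrightarrow> tle T v u \<Longrightarrow> tle T p u"
  shows "phi T C x = p"
proof -
  have "p \<in> verts T" using assms tle_verts[of x p] by (auto simp: tless_iff)
  then show ?thesis
    unfolding phi_def Let_def
    by (intro the_equality) (use assms in \<open>blast intro: tle_eqI tle_height\<close>)+
qed

lemma phiE:
  assumes "fst ` C \<subseteq> verts T" "C \<noteq> {}" "x \<in> verts T" "\<And>v. v \<in> fst ` C \<Longrightarrow> \<not> tle T v x"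
  obtains v where "tless T x (phi T C x)" "v \<in> fst ` C" "tle T v (phi T C x)"
    "\<And>u v. tless T x u \<Longrightarrow> v \<in> fst ` C \<Longrightarrow> tle T v u \<Longrightarrow> tle T (phi T C x) u"
proof -
  define S where "S = {u \<in> verts T. tless T x u \<and> (\<exists>v\<in>fst ` C. tle T v u)}"
  have fin: "finite S" using finite_verts by (simp add: S_def)
  obtain c where c: "c \<in> fst ` C" using assms by auto
  then have "x \<noteq> root T" using assms below_root by blast
  then have "root T \<in> S"
    using c assms root_in_verts below_root by (auto simp: S_def tless_iff)
  then obtain p where p: "p \<in> S" "\<And>u. u \<in> S \<Longrightarrow> height T p \<le> height T u"
    using ex_minimizer[OF fin, of "height T"] by auto
  have least: "tle T p u" if "tless T x u" "v \<in> fst ` C" "tle T v u" for u v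
  proof -
    have "u \<in> S" using that tle_verts assms by (auto simp: S_def tless_iff)
    then show ?thesis using p tle_chain[of x p u] that(1) by (auto simp: S_def tless_iff)
  qed
  obtain v where v: "v \<in> fst ` C" "tle T v p" "tless T x p" using p by (auto simp: S_def)
  have "phi T C x = p"
    using phi_eqI[OF assms(3)] v least by blast
  then show ?thesis using that v least by blast
qed

text \<open>If nothing coupled lies below \<open>y\<close>, an ancestor of \<open>x\<close> which has something coupled below it can not lie
  between \<open>x\<close> and \<open>y\<close>.\<close>

lemma phi_cong_tle:
  assumes "tle T x y" "\<And>v. v \<in> fst ` C \<Longrightarrow> \<not> tle T v y"
  shows "phi T C x = phi T C y"
proof -
  have "tless T y u" if "tless T x u" "v \<in> fst ` C" "tle T v u" for u v
  proof -
    have "\<not> tle T u y" using that assms(2) by (meson rtrancl_trans)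
    then show ?thesis
      using tle_chain[of x y u] tle_chain[of x u y] assms(1) that(1)
      by (cases "height T y \<le> height T u") (auto simp: tless_iff)
  qed
  then have "{u \<in> verts T. tless T x u \<and> (\<exists>v\<in>fst ` C. tle T v u)} =
    {u \<in> verts T. tless T y u \<and> (\<exists>v\<in>fst ` C. tle T v u)}"
    using assms(1) by (auto intro: rtrancl_trancl_trancl)
  then show ?thesis by (simp add: phi_def)
qed

end

section \<open>The vertex map and the cost of a coupling\<close>

locale tree_coupling = T: merge_tree T + G: merge_tree G
  for T :: "'a mtree" and G :: "'b mtree" +
  fixes C :: "('a \<times> 'b) set"
  assumes coupling: "C \<in> couplings T G"
begin

lemma C_verts: "(v, w) \<in> C \<Longrightarrow> v \<in> verts T \<and> w \<in> verts G"
  using coupling by (auto simp: couplings_def)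

lemma fst_C_verts: "fst ` C \<subseteq> verts T"
  using C_verts by auto

lemma C_nonempty: "C \<noteq> {}"
  using coupling by (auto simp: couplings_def)

lemma C_mono:
  assumes "(v, w) \<in> C" "(v', w') \<in> C" "tle T v v'"
  shows "tle G w w'"
proof (cases "v = v'")
  case True
  then have "(v, w) = (v', w')"
    using assms(1,2) coupling inj_onD[of fst C "(v, w)" "(v', w')"] by (auto simp: couplings_def)
  then show ?thesis by simp
next
  case False
  then have "tless T v v'" using assms(3) T.tless_iff by blast
  then have "tless G w w'"
    using assms(1,2) coupling unfolding couplings_def by blast
  then show ?thesis by simp
qed

lemma matched_not_unused: "v \<in> fst ` C \<Longrightarrow> v \<notin> unused T C"
  using coupling by (auto simp: couplings_def unused_def)

lemma uncoupled_below:
  assumes "x \<in> verts T" "\<And>v. v \<in> fst ` C \<Longrightarrow> \<not> tle T v x"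
  shows "x \<in> deleted T C" "Lambda T C x = {}"
proof -
  show "Lambda T C x = {}" using assms by (auto simp: Lambda_def T.tless_iff)
  then show "x \<in> deleted T C" using assms by (auto simp: deleted_def)
qed

lemma eta_below_phi:
  assumes "x \<in> verts T" "\<And>v. v \<in> fst ` C \<Longrightarrow> \<not> tle T v x"
  obtains v where "(v, eta T G C x) \<in> C" "tle T v (phi T C x)"
proof -
  define W where "W = {w. \<exists>v. (v, w) \<in> C \<and> tle T v (phi T C x)}"
  have fin: "finite W"
    by (rule finite_subset[OF _ G.finite_verts]) (use C_verts in \<open>auto simp: W_def\<close>)
  obtain v where "v \<in> fst ` C" "tle T v (phi T C x)"
    using T.phiE[OF fst_C_verts C_nonempty assms] by metis
  then have "W \<noteq> {}" unfolding W_def by force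
  then have "eta T G C x \<in> W"
    unfolding eta_def W_def[symmetric] using arg_min_if_finite(1) fin by blast
  then show ?thesis using that by (auto simp: W_def)
qed

lemma eta_le:
  assumes "(v, w) \<in> C" "tle T v (phi T C x)"
  shows "height G (eta T G C x) \<le> height G w"
  unfolding eta_def
proof (rule arg_min_least)
  show "finite {w. \<exists>v. (v, w) \<in> C \<and> tle T v (phi T C x)}"
    by (rule finite_subset[OF _ G.finite_verts]) (use C_verts in auto)
qed (use assms in auto)

lemma nothing_coupled_below:
  assumes "x \<in> deleted T C" "Lambda T C x = {}" "v \<in> fst ` C"
  shows "\<not> tle T v x"
proof
  assume "tle T v x"
  moreover have "v \<noteq> x" using assms by (auto simp: deleted_def)
  ultimately have "tless T v x" using T.tless_iff by blast
  then show False using T.ex_Lambda[OF fst_C_verts assms(3)] assms(2) by blast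
qed

lemma vertex_map_matched:
  assumes "(v, w) \<in> C"
  shows "vertex_map T G C v = vpoint G w"
proof -
  have "(THE w. (v, w) \<in> C) = w"
    using assms C_mono by (blast intro: the_equality G.tle_eqI G.tle_height)
  then show ?thesis using assms by (force simp: vertex_map_def)
qed

lemma vertex_map_branch:
  assumes "x \<in> deleted T C" "card (Lambda T C x) > 1"
  shows "vertex_map T G C x = vpoint G (chi T G C x)"
  using assms by (auto simp: vertex_map_def deleted_def)

lemma mheight_vertex_map_leaf:
  assumes x: "x \<in> deleted T C" "Lambda T C x = {}"
  shows "mheight (vertex_map T G C x) =
    max (height G (eta T G C x)) ((height T x + height T (phi T C x)) / 2)"
proof -
  have "x \<in> verts T" using x by (simp add: deleted_def)
  then obtain v where "(v, eta T G C x) \<in> C"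
    using eta_below_phi nothing_coupled_below[OF x] by blast
  then have "eta T G C x \<in> verts G" using C_verts by blast
  moreover have "vertex_map T G C x = point_above G (vpoint G (eta T G C x))
      (max (height G (eta T G C x)) ((height T x + height T (phi T C x)) / 2))"
    using x by (auto simp: vertex_map_def deleted_def)
  ultimately show ?thesis by (simp add: G.mheight_point_above)
qed

lemma not_unused_cases:
  assumes "x \<in> verts T - unused T C"
  obtains w where "(x, w) \<in> C" | "x \<in> deleted T C" "card (Lambda T C x) > 1"
    | "x \<in> deleted T C" "Lambda T C x = {}"
proof (cases "x \<in> fst ` C")
  case True
  then show ?thesis using that(1) by auto
next
  case False
  then have "x \<in> deleted T C" "card (Lambda T C x) \<noteq> 1"
    using assms by (auto simp: deleted_def unused_def)
  moreover have "card (Lambda T C x) \<noteq> 0" if "Lambda T C x \<noteq> {}"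
    using that T.finite_Lambda[OF fst_C_verts] by simp
  ultimately show ?thesis
    using that(2,3) by linarith
qed

lemma tree_coupling_converse: "tree_coupling G T (C\<inverse>)"
  using couplings_converse[OF coupling] T.merge_tree_axioms G.merge_tree_axioms
  by (simp add: tree_coupling_def tree_coupling_axioms_def)

lemma cost_le_iff:
  "cost T G C \<le> \<epsilon> \<longleftrightarrow>
    (\<forall>x\<in>verts T - unused T C. \<bar>mheight (vertex_map T G C x) - height T x\<bar> \<le> \<epsilon>) \<and>
    (\<forall>y\<in>verts G - unused G (C\<inverse>). \<bar>mheight (vertex_map G T (C\<inverse>) y) - height G y\<bar> \<le> \<epsilon>)"
proof -
  interpret conv: tree_coupling G T "C\<inverse>" by (rule tree_coupling_converse)
  obtain a b where "(a, b) \<in> C" using C_nonempty by auto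
  then have "a \<in> verts T - unused T C" "b \<in> verts G - unused G (C\<inverse>)"
    using matched_not_unused conv.matched_not_unused C_verts by force+
  then have "verts T - unused T C \<noteq> {}" "verts G - unused G (C\<inverse>) \<noteq> {}" by blast+
  then show ?thesis
    unfolding cost_def using T.finite_verts G.finite_verts by simp
qed

end

section \<open>From a coupling to compatible maps\<close>

text \<open>Among the partners of the coupled vertices below \<open>x\<close> any choice gives the same map, by
  \<open>partners_merge\<close>. With nothing coupled below \<open>x\<close> the choice matters, because the cost only
  guarantees that the image of \<open>x\<close> is high enough to lie above \<open>\<eta>\<close>, the lowest partner available.\<close>

definition partner_below :: "'a mtree \<Rightarrow> 'b mtree \<Rightarrow> ('a \<times> 'b) set \<Rightarrow> 'a \<Rightarrow> 'b" where
  "partner_below T G C x =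
     (if \<exists>v\<in>fst ` C. tle T v x then SOME w. \<exists>v. (v, w) \<in> C \<and> tle T v x else eta T G C x)"

definition coupling_map :: "'a mtree \<Rightarrow> 'b mtree \<Rightarrow> ('a \<times> 'b) set \<Rightarrow> real \<Rightarrow> 'a mpoint \<Rightarrow> 'b mpoint" where
  "coupling_map T G C \<epsilon> x =
     point_above G (vpoint G (partner_below T G C (fst x))) (mheight x + \<epsilon>)"

text \<open>The bounds are one-sided: the lower bound for matched vertices is the upper bound for the
  converse coupling.\<close>

locale bounded_coupling = tree_coupling T G C
  for T :: "'a mtree" and G :: "'b mtree" and C :: "('a \<times> 'b) set" +
  fixes \<epsilon> :: real
  assumes matched_bound: "(v, w) \<in> C \<Longrightarrow> height G w \<le> height T v + \<epsilon>"
    and branch_bound: "x \<in> deleted T C \<Longrightarrow> card (Lambda T C x) > 1 \<Longrightarrow>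
      height G (chi T G C x) \<le> height T x + \<epsilon>"
    and phi_bound: "x \<in> deleted T C \<Longrightarrow> Lambda T C x = {} \<Longrightarrow>
      height T (phi T C x) \<le> height T x + 2 * \<epsilon>"
    and eta_bound: "x \<in> deleted T C \<Longrightarrow> Lambda T C x = {} \<Longrightarrow>
      height G (eta T G C x) \<le> height T x + \<epsilon>"
begin

text \<open>The least common ancestor \<open>m\<close> of two coupled vertices is coupled, or else it has two maximal coupled
  vertices below it and is a deleted branching vertex. In both cases the image of \<open>m\<close> is above both
  partners, and the cost bounds its height.\<close>

lemma partners_merge:
  assumes "(v, w) \<in> C" "(v', w') \<in> C" "tle T v a" "tle T v' a"
  obtains n where "n \<in> verts G" "tle G w n" "tle G w' n" "height G n \<le> height T a + \<epsilon>"
proof -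
  define m where "m = LCA T {v, v'}"
  have vv: "{v, v'} \<subseteq> verts T" using assms C_verts by auto
  have m: "m \<in> verts T" "tle T v m" "tle T v' m" "tle T m a"
    unfolding m_def using assms vv T.tle_verts
    by (auto intro!: T.LCA_in_verts T.LCA_upper T.LCA_least)
  have ma: "height T m \<le> height T a" using m T.tle_height by blast
  show ?thesis
  proof (cases "m \<in> fst ` C")
    case True
    then obtain n where n: "(m, n) \<in> C" by auto
    show ?thesis
      using that[of n] C_mono[OF assms(1) n m(2)] C_mono[OF assms(2) n m(3)] matched_bound[OF n] ma
        C_verts[OF n] by auto
  next
    case False
    then have "tless T v m" "tless T v' m"
      using assms m by (force simp: T.tless_iff)+
    then obtain u u' where u: "u \<in> Lambda T C m" "tle T v u" and u': "u' \<in> Lambda T C m" "tle T v' u'"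
      using T.ex_Lambda[OF fst_C_verts] assms by (metis fst_conv image_eqI)
    have um: "tless T u m" "u \<in> verts T" using u fst_C_verts by (auto simp: Lambda_def)
    have "u \<noteq> u'"
    proof
      assume "u = u'"
      then have "tle T m u"
        unfolding m_def using um u u' vv by (intro T.LCA_least) auto
      then show False using um T.tle_eqI T.tle_height by (metis T.tless_iff)
    qed
    then have "\<not> card (Lambda T C m) \<le> 1"
      using u u' card_le_Suc0_iff_eq[OF T.finite_Lambda[OF fst_C_verts]] by auto
    then have card: "card (Lambda T C m) > 1" by simp
    then have "height G (chi T G C m) \<le> height T m + \<epsilon>"
      using branch_bound False m by (simp add: deleted_def)
    moreover define W where "W = {w. \<exists>v. (v, w) \<in> C \<and> v \<in> Lambda T C m}"
    obtain b where b: "(u, b) \<in> C" using u by (auto simp: Lambda_def)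
    obtain b' where b': "(u', b') \<in> C" using u' by (auto simp: Lambda_def)
    have W: "W \<subseteq> verts G" "b \<in> W" "b' \<in> W" using b b' u u' C_verts by (auto simp: W_def)
    then have "tle G b (chi T G C m)" "tle G b' (chi T G C m)" "chi T G C m \<in> verts G"
      unfolding chi_def W_def[symmetric] by (auto intro!: G.LCA_upper G.LCA_in_verts)
    ultimately show ?thesis
      using that[of "chi T G C m"] ma C_mono[OF assms(1) b u(2)] C_mono[OF assms(2) b' u'(2)]
      by (meson order_trans rtrancl_trans add_right_mono)
  qed
qed

lemma partner_below:
  assumes "x \<in> verts T"
  obtains v where "(v, partner_below T G C x) \<in> C"
    "height G (partner_below T G C x) \<le> height T x + \<epsilon>"
    "tle T v x \<or> (\<forall>v\<in>fst ` C. \<not> tle T v x) \<and> partner_below T G C x = eta T G C x \<and>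
      tle T v (phi T C x)"
proof (cases "\<exists>v\<in>fst ` C. tle T v x")
  case True
  then have "\<exists>w v. (v, w) \<in> C \<and> tle T v x" by force
  then have "\<exists>v. (v, partner_below T G C x) \<in> C \<and> tle T v x"
    unfolding partner_below_def if_P[OF True] by (rule someI_ex)
  then obtain v where v: "(v, partner_below T G C x) \<in> C" "tle T v x" by blast
  moreover have "height G (partner_below T G C x) \<le> height T x + \<epsilon>"
    using matched_bound[OF v(1)] T.tle_height[OF v(2)] by simp
  ultimately show ?thesis using that by blast
next
  case False
  then have "\<And>v. v \<in> fst ` C \<Longrightarrow> \<not> tle T v x" by blast
  then obtain v where "(v, eta T G C x) \<in> C" "tle T v (phi T C x)"
    "height G (eta T G C x) \<le> height T x + \<epsilon>"
    using eta_below_phi[OF assms] eta_bound uncoupled_below[OF assms] by metis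
  then show ?thesis using that[of v] False by (simp add: partner_below_def)
qed

lemma
  assumes "x \<in> mpoints T"
  shows mheight_coupling_map: "mheight (coupling_map T G C \<epsilon> x) = mheight x + \<epsilon>"
    and coupling_map_in: "coupling_map T G C \<epsilon> x \<in> mpoints G"
    and partner_below_coupling_map:
      "mle G (vpoint G (partner_below T G C (fst x))) (coupling_map T G C \<epsilon> x)"
proof -
  have x: "fst x \<in> verts T" "height T (fst x) \<le> mheight x" using T.mpointD assms by auto
  obtain v where "(v, partner_below T G C (fst x)) \<in> C"
      "height G (partner_below T G C (fst x)) \<le> height T (fst x) + \<epsilon>"
    using partner_below[OF x(1)] by blast
  then have p: "vpoint G (partner_below T G C (fst x)) \<in> mpoints G"
    "mheight (vpoint G (partner_below T G C (fst x))) \<le> mheight x + \<epsilon>"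
    using C_verts x by auto
  show "mheight (coupling_map T G C \<epsilon> x) = mheight x + \<epsilon>"
    "coupling_map T G C \<epsilon> x \<in> mpoints G"
    "mle G (vpoint G (partner_below T G C (fst x))) (coupling_map T G C \<epsilon> x)"
    unfolding coupling_map_def
    using p by (auto intro: G.mheight_point_above G.point_above_in G.mle_point_above)
qed

lemma partner_le_coupling_map:
  assumes "x \<in> mpoints T" "(v, w) \<in> C" "tle T v (fst x)"
  shows "mle G (vpoint G w) (coupling_map T G C \<epsilon> x)"
proof -
  have x: "fst x \<in> verts T" "height T (fst x) \<le> mheight x" using T.mpointD assms by auto
  obtain v' where v': "(v', partner_below T G C (fst x)) \<in> C" "tle T v' (fst x)"
    using partner_below[OF x(1)] assms by (metis fst_conv image_eqI)
  obtain n where n: "n \<in> verts G" "tle G w n" "tle G (partner_below T G C (fst x)) n"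
      "height G n \<le> height T (fst x) + \<epsilon>"
    using partners_merge[OF assms(2) v'(1) assms(3) v'(2)] by blast
  have "mle G (vpoint G (partner_below T G C (fst x))) (vpoint G n)"
    using n C_verts[OF v'(1)] by (auto simp: G.mle_vpoint_iff)
  then have "mle G (vpoint G n) (coupling_map T G C \<epsilon> x)"
    using G.mle_chain[OF _ partner_below_coupling_map[OF assms(1)]] mheight_coupling_map[OF assms(1)] n x
    by auto
  moreover have "mle G (vpoint G w) (vpoint G n)"
    using n C_verts[OF assms(2)] by (auto simp: G.mle_vpoint_iff)
  ultimately show ?thesis using G.mle_trans by blast
qed

lemma coupling_map_mono:
  assumes "mle T x y"
  shows "mle G (coupling_map T G C \<epsilon> x) (coupling_map T G C \<epsilon> y)"
proof -
  have xy: "x \<in> mpoints T" "y \<in> mpoints T" "tle T (fst x) (fst y)" "mheight x \<le> mheight y"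
    using assms by (auto simp: mle_def)
  have v: "fst x \<in> verts T" using T.mpointD xy by blast
  define w where "w = partner_below T G C (fst x)"
  have "mle G (vpoint G w) (coupling_map T G C \<epsilon> y)"
  proof (cases "\<exists>v\<in>fst ` C. tle T v (fst y)")
    case True
    obtain v where v: "(v, w) \<in> C"
      "tle T v (fst x) \<or> (\<forall>v\<in>fst ` C. \<not> tle T v (fst x)) \<and> tle T v (phi T C (fst x))"
      using partner_below[OF v] unfolding w_def by metis
    have "tle T v (fst y)"
    proof (cases "tle T v (fst x)")
      case True
      then show ?thesis using xy by (meson rtrancl_trans)
    next
      case False
      then have none: "\<And>v. v \<in> fst ` C \<Longrightarrow> \<not> tle T v (fst x)" using v by blast
      then have "tless T (fst x) (fst y)" using True xy T.tless_iff by metis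
      then have "tle T (phi T C (fst x)) (fst y)"
        using T.phiE[OF fst_C_verts C_nonempty \<open>fst x \<in> verts T\<close> none] True by metis
      then show ?thesis using v False by (meson rtrancl_trans)
    qed
    then show ?thesis using partner_le_coupling_map xy v by blast
  next
    case False
    then have "\<not> (\<exists>v\<in>fst ` C. tle T v (fst x))" using xy by (meson rtrancl_trans)
    moreover have "phi T C (fst x) = phi T C (fst y)"
      using T.phi_cong_tle xy False by blast
    ultimately have "w = partner_below T G C (fst y)"
      using False by (simp add: w_def partner_below_def eta_def)
    then show ?thesis using partner_below_coupling_map xy by simp
  qed
  then show ?thesis
    using G.mle_chain[OF partner_below_coupling_map[OF xy(1)], folded w_def] xy mheight_coupling_map
    by simp
qed

lemma continuous_coupling_map: "continuous_map (mtop T) (mtop G) (coupling_map T G C \<epsilon>)"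
  using continuous_map_mtop_if_mono[OF T.merge_tree_axioms G.merge_tree_axioms]
    coupling_map_in mheight_coupling_map coupling_map_mono by blast

text \<open>A point \<open>x\<close> below which nothing is coupled is sent above the partner of some \<open>v\<close> and returns
  above \<open>v\<close>, at a height at least that of \<open>\<phi>\<close>. As \<open>\<phi>\<close> is above both \<open>v\<close> and \<open>x\<close>, so is the end.\<close>

lemma coupling_map_coupling_map:
  assumes "bounded_coupling G T (C\<inverse>) \<epsilon>" "x \<in> mpoints T"
  shows "coupling_map G T (C\<inverse>) \<epsilon> (coupling_map T G C \<epsilon> x) = shift T (2 * \<epsilon>) x"
proof -
  interpret conv: bounded_coupling G T "C\<inverse>" \<epsilon> by fact
  define y where "y = coupling_map T G C \<epsilon> x"
  define z where "z = coupling_map G T (C\<inverse>) \<epsilon> y"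
  have x: "fst x \<in> verts T" "height T (fst x) \<le> mheight x" using T.mpointD assms by auto
  have y: "y \<in> mpoints G" "mheight y = mheight x + \<epsilon>"
    unfolding y_def using assms coupling_map_in mheight_coupling_map by auto
  have z: "z \<in> mpoints T" "mheight z = mheight x + 2 * \<epsilon>"
    unfolding z_def using y conv.coupling_map_in conv.mheight_coupling_map by auto
  obtain v where v: "(v, partner_below T G C (fst x)) \<in> C"
    "tle T v (fst x) \<or> (\<forall>v\<in>fst ` C. \<not> tle T v (fst x)) \<and> tle T v (phi T C (fst x))"
    using partner_below[OF x(1)] by metis
  have vv: "v \<in> verts T" using v C_verts by blast
  have "tle G (partner_below T G C (fst x)) (fst y)"
    using partner_below_coupling_map[OF assms(2)] by (auto simp: y_def mle_def)
  then have vz: "mle T (vpoint T v) z"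
    unfolding z_def using conv.partner_le_coupling_map y v by blast
  have \<epsilon>: "0 \<le> \<epsilon>"
  proof -
    obtain a b where "(a, b) \<in> C" using C_nonempty by auto
    then show ?thesis using matched_bound[of a b] conv.matched_bound[of b a] by auto
  qed
  have "mle T x z"
  proof (cases "tle T v (fst x)")
    case True
    then have "mle T (vpoint T v) x" using assms vv by (simp add: T.mle_vpoint_iff)
    then show ?thesis using T.mle_chain[OF _ vz] z \<epsilon> by simp
  next
    case False
    then have none: "\<And>v. v \<in> fst ` C \<Longrightarrow> \<not> tle T v (fst x)" and vphi: "tle T v (phi T C (fst x))"
      using v by blast+
    have xphi: "tle T (fst x) (phi T C (fst x))"
      using T.phiE[OF fst_C_verts C_nonempty x(1) none] T.tless_iff by metis
    have "height T (phi T C (fst x)) \<le> mheight z"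
      using phi_bound uncoupled_below[OF x(1) none] z x by fastforce
    moreover have phi: "phi T C (fst x) \<in> verts T" using T.tle_verts xphi x by blast
    moreover have "mle T (vpoint T v) (vpoint T (phi T C (fst x)))"
      using vv vphi phi by (simp add: T.mle_vpoint_iff)
    ultimately have "mle T (vpoint T (phi T C (fst x))) z"
      using T.mle_chain[OF _ vz] by simp
    then have "mle T (vpoint T (fst x)) z"
      using T.mle_vpoint_iff[OF phi z(1)] T.mle_vpoint_iff[OF x(1) z(1)] rtrancl_trans[OF xphi] by blast
    then show ?thesis using T.mle_chain[OF T.mle_vpoint_fst[OF assms(2)]] z \<epsilon> by simp
  qed
  then have "point_above T x (mheight x + 2 * \<epsilon>) = z" using z T.point_above_eqI by blast
  then show ?thesis by (simp add: shift_def z_def y_def)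
qed

end

lemma (in tree_coupling) bounded_coupling_cost: "bounded_coupling T G C (cost T G C)"
proof
  have bound: "\<bar>mheight (vertex_map T G C x) - height T x\<bar> \<le> cost T G C"
    if "x \<in> verts T" "x \<notin> unused T C" for x
    using cost_le_iff[of "cost T G C"] that by blast
  have deleted: "x \<in> verts T" "x \<notin> unused T C" if "x \<in> deleted T C" for x
    using that by (auto simp: deleted_def unused_def)
  show "height G w \<le> height T v + cost T G C" if "(v, w) \<in> C" for v w
    using bound[of v] matched_not_unused[of v] C_verts[OF that] vertex_map_matched[OF that] that
    by force
  show "height G (chi T G C x) \<le> height T x + cost T G C"
    if "x \<in> deleted T C" "card (Lambda T C x) > 1" for x
    using bound[OF deleted[OF that(1)]] vertex_map_branch[OF that] by simp
  show "height T (phi T C x) \<le> height T x + 2 * cost T G C"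
    "height G (eta T G C x) \<le> height T x + cost T G C"
    if "x \<in> deleted T C" "Lambda T C x = {}" for x
  proof -
    have "max (height G (eta T G C x)) ((height T x + height T (phi T C x)) / 2) \<le>
        height T x + cost T G C"
      using bound[OF deleted[OF that(1)]] unfolding mheight_vertex_map_leaf[OF that] by linarith
    then show "height T (phi T C x) \<le> height T x + 2 * cost T G C"
      "height G (eta T G C x) \<le> height T x + cost T G C"
      by auto
  qed
qed

lemma cost_converse: "cost G T (C\<inverse>) = cost T G C"
  by (simp add: cost_def max.commute)

lemma (in tree_coupling) cost_nonneg: "0 \<le> cost T G C"
proof -
  obtain a b where "(a, b) \<in> C" using C_nonempty by auto
  then have "a \<in> verts T - unused T C" using matched_not_unused C_verts by force
  then have "\<bar>mheight (vertex_map T G C a) - height T a\<bar> \<le> cost T G C"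
    using cost_le_iff[of "cost T G C"] by blast
  then show ?thesis by linarith
qed

lemma (in tree_coupling) compatible_maps_cost:
  "compatible_maps T G (cost T G C)
     (coupling_map T G C (cost T G C)) (coupling_map G T (C\<inverse>) (cost T G C))"
proof -
  interpret conv: tree_coupling G T "C\<inverse>" by (rule tree_coupling_converse)
  interpret A: bounded_coupling T G C "cost T G C" by (rule bounded_coupling_cost)
  interpret B: bounded_coupling G T "C\<inverse>" "cost T G C"
    using conv.bounded_coupling_cost by (simp add: cost_converse)
  have "coupling_map T G C (cost T G C) (coupling_map G T (C\<inverse>) (cost T G C) y) = shift G (2 * cost T G C) y"
    if "y \<in> mpoints G" for y
    using B.coupling_map_coupling_map[of y] that A.bounded_coupling_axioms by simp
  then show ?thesis
    unfolding compatible_maps_def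
    using A.continuous_coupling_map B.continuous_coupling_map A.coupling_map_in B.coupling_map_in
      A.mheight_coupling_map B.mheight_coupling_map A.coupling_map_coupling_map[OF B.bounded_coupling_axioms]
    by simp
qed

section \<open>Selecting pairs in two ultrametrics\<close>

text \<open>The diagonal values are the heights of the vertices rather than zero.\<close>

locale ultrametric =
  fixes V :: "'a set" and J :: "'a \<Rightarrow> 'a \<Rightarrow> real"
  assumes finite_carrier: "finite V"
    and commute: "x \<in> V \<Longrightarrow> y \<in> V \<Longrightarrow> J x y = J y x"
    and self_le: "x \<in> V \<Longrightarrow> y \<in> V \<Longrightarrow> J x x \<le> J x y"
    and ultra: "x \<in> V \<Longrightarrow> y \<in> V \<Longrightarrow> z \<in> V \<Longrightarrow> J x z \<le> max (J x y) (J y z)"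
begin

lemma ultra_le: "x \<in> V \<Longrightarrow> y \<in> V \<Longrightarrow> z \<in> V \<Longrightarrow> J x y \<le> t \<Longrightarrow> J y z \<le> t \<Longrightarrow> J x z \<le> t"
  using ultra[of x y z] by linarith

end

locale ultrametric_pair = A: ultrametric V J + B: ultrametric W K
  for V :: "'a set" and J and W :: "'b set" and K +
  fixes \<epsilon> :: real
  assumes eps_nonneg: "0 \<le> \<epsilon>"
begin

definition matching :: "('a \<times> 'b) set \<Rightarrow> bool" where
  "matching L \<longleftrightarrow> L \<subseteq> V \<times> W \<and>
     (\<forall>p\<in>L. \<forall>q\<in>L. \<bar>J (fst p) (fst q) - K (snd p) (snd q)\<bar> \<le> \<epsilon>) \<and>
     (\<forall>p\<in>L. \<forall>q\<in>L. p \<noteq> q \<longrightarrow> J (fst p) (fst p) < J (fst p) (fst q) \<and> K (snd p) (snd p) < K (snd p) (snd q))"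

text \<open>The two covering conditions are not symmetric, on purpose: \<open>coversV\<close> compares \<open>v\<close> with \<open>x\<close> without
  any slack and so, in a matching, bounds \<open>K w w\<close> by \<open>J x x + \<epsilon>\<close>. The exact comparison is
  what makes the condition transitive, so that a pair may be dropped in favour of one that covers its \<open>v\<close>.\<close>

definition coversV :: "'a \<times> 'b \<Rightarrow> 'a \<Rightarrow> bool" where
  "coversV p x \<longleftrightarrow> J (fst p) (fst p) \<le> J x x \<and> J x (fst p) \<le> J x x + 2 * \<epsilon>"

definition coversW :: "'a \<times> 'b \<Rightarrow> 'b \<Rightarrow> bool" where
  "coversW p y \<longleftrightarrow> J (fst p) (fst p) \<le> K y y + \<epsilon> \<and> K y (snd p) \<le> K y y + 2 * \<epsilon>"

definition covering :: "('a \<times> 'b) set \<Rightarrow> bool" where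
  "covering L \<longleftrightarrow> (\<forall>x\<in>V. \<exists>p\<in>L. coversV p x) \<and> (\<forall>y\<in>W. \<exists>p\<in>L. coversW p y)"

definition nearest_cheap :: "('a \<times> 'b) set \<Rightarrow> bool" where
  "nearest_cheap L \<longleftrightarrow>
    (\<forall>x\<in>V. \<exists>p\<in>L. (\<forall>q\<in>L. J x (fst p) \<le> J x (fst q)) \<and>
       J x (fst p) \<le> J x x + 2 * \<epsilon> \<and> K (snd p) (snd p) \<le> J x x + \<epsilon>) \<and>
    (\<forall>y\<in>W. \<exists>p\<in>L. (\<forall>q\<in>L. K y (snd p) \<le> K y (snd q)) \<and>
       K y (snd p) \<le> K y y + 2 * \<epsilon> \<and> J (fst p) (fst p) \<le> K y y + \<epsilon>)"

lemma matchingD: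
  assumes "matching L" "p \<in> L"
  shows "fst p \<in> V" "snd p \<in> W" "J (fst p) (fst p) \<le> K (snd p) (snd p) + \<epsilon>"
    "K (snd p) (snd p) \<le> J (fst p) (fst p) + \<epsilon>"
    "q \<in> L \<Longrightarrow> J (fst p) (fst q) \<le> K (snd p) (snd q) + \<epsilon>"
    "q \<in> L \<Longrightarrow> K (snd p) (snd q) \<le> J (fst p) (fst q) + \<epsilon>"
proof -
  show "fst p \<in> V" "snd p \<in> W" using assms by (auto simp: matching_def)
  have dist: "\<bar>J (fst p) (fst q) - K (snd p) (snd q)\<bar> \<le> \<epsilon>" if "q \<in> L" for q
    using assms that by (simp add: matching_def)
  show "J (fst p) (fst p) \<le> K (snd p) (snd p) + \<epsilon>" "K (snd p) (snd p) \<le> J (fst p) (fst p) + \<epsilon>"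
    using dist[OF assms(2)] by linarith+
  show "J (fst p) (fst q) \<le> K (snd p) (snd q) + \<epsilon>" "K (snd p) (snd q) \<le> J (fst p) (fst q) + \<epsilon>"
    if "q \<in> L"
    using dist[OF that] by linarith+
qed

lemma matching_subset:
  assumes "matching L" "L' \<subseteq> L"
  shows "matching L'"
proof -
  have sub: "\<forall>p\<in>L'. \<forall>q\<in>L'. P p q" if "\<forall>p\<in>L. \<forall>q\<in>L. P p q" for P
    using that assms(2) by (intro ballI) (meson subsetD)
  show ?thesis
    using assms unfolding matching_def
    by (elim conjE, intro conjI sub) (rule subset_trans, assumption+)
qed

lemma coveringD:
  assumes "covering L"
  shows "x \<in> V \<Longrightarrow> \<exists>p\<in>L. coversV p x" "y \<in> W \<Longrightarrow> \<exists>p\<in>L. coversW p y"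
  using assms unfolding covering_def by blast+

text \<open>Let \<open>i\<close> cover \<open>y\<close>. Then the \<open>v\<close> of the expensive pair \<open>j\<close> is higher than that of \<open>i\<close>, and the two pairs
  merge, on both sides, so early that \<open>i\<close> covers everything that \<open>j\<close> covers.\<close>

lemma drop_pair_W:
  assumes L: "matching L" "covering L" and y: "y \<in> W" and j: "j \<in> L"
    and nearest: "\<And>q. q \<in> L \<Longrightarrow> K y (snd j) \<le> K y (snd q)"
    and expensive: "J (fst j) (fst j) > K y y + \<epsilon>"
  shows "covering (L - {j})"
proof -
  obtain i where i: "i \<in> L" "coversW i y" using coveringD[OF L(2)] y by meson
  have ij: "i \<in> L - {j}" using i expensive by (auto simp: coversW_def)
  note [simp] = matchingD(1,2)[OF L(1) i(1)] matchingD(1,2)[OF L(1) j] y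
  have yi: "K y (snd i) \<le> K y y + 2 * \<epsilon>" "J (fst i) (fst i) \<le> K y y + \<epsilon>"
    using i by (auto simp: coversW_def)
  have yj: "K (snd j) y \<le> K y y + 2 * \<epsilon>"
    using nearest[OF i(1)] yi B.commute[of y "snd j"] by simp
  have Kji: "K (snd j) (snd i) \<le> K y y + 2 * \<epsilon>"
    using B.ultra_le[of "snd j" y "snd i"] yi yj by simp
  have Jji: "J (fst j) (fst i) \<le> J (fst j) (fst j) + 2 * \<epsilon>"
    using matchingD(5)[OF L(1) j i(1)] Kji expensive by linarith
  have "\<exists>p\<in>L - {j}. coversV p x" if "x \<in> V" for x
  proof -
    obtain p where p: "p \<in> L" "coversV p x" using coveringD(1)[OF L(2) \<open>x \<in> V\<close>] by blast
    have "coversV i x" if "p = j"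
      using p that A.ultra_le[of x "fst j" "fst i" "J x x + 2 * \<epsilon>"] \<open>x \<in> V\<close> Jji expensive yi
      by (auto simp: coversV_def)
    then show ?thesis using p ij by blast
  qed
  moreover have "\<exists>p\<in>L - {j}. coversW p z" if "z \<in> W" for z
  proof -
    obtain p where p: "p \<in> L" "coversW p z" using coveringD(2)[OF L(2) \<open>z \<in> W\<close>] by blast
    have "coversW i z" if "p = j"
      using p that B.ultra_le[of z "snd j" "snd i" "K z z + 2 * \<epsilon>"] \<open>z \<in> W\<close> Kji expensive yi
      by (auto simp: coversW_def)
    then show ?thesis using p ij by blast
  qed
  ultimately show ?thesis by (auto simp: covering_def)
qed

text \<open>If \<open>i\<close> covers \<open>x\<close>, then \<open>i\<close> covers every element of \<open>V\<close> that the expensive pair \<open>j\<close> covers, and every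
  element of \<open>W\<close> that \<open>j\<close> covers and that is at least as high as the \<open>w\<close> of \<open>j\<close>. So if
  \<open>j\<close> can not be dropped, the reason is some \<open>y\<close> lower than that \<open>w\<close> which only \<open>j\<close> covers. The lowest such \<open>y\<close> is a better partner for the \<open>v\<close> of
  \<open>j\<close>. The other pairs whose \<open>w\<close> merges with \<open>y\<close> within \<open>2 * \<epsilon>\<close> have to go, as they could violate the
  distortion bound; since they do not cover \<open>y\<close>, their \<open>v\<close> is high, and the new pair takes over.\<close>

lemma improve_pair_V:
  assumes L: "matching L" "covering L" and x: "x \<in> V" and j: "j \<in> L"
    and nearest: "\<And>q. q \<in> L \<Longrightarrow> J x (fst j) \<le> J x (fst q)"
    and expensive: "K (snd j) (snd j) > J x x + \<epsilon>"
  shows "covering (L - {j}) \<or>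
    (\<exists>y\<in>W. \<exists>L'\<subseteq>L - {j}. K y y < K (snd j) (snd j) \<and> (fst j, y) \<notin> L' \<and>
      matching (insert (fst j, y) L') \<and> covering (insert (fst j, y) L'))"
proof -
  note D = matchingD[OF L(1)]
  obtain i where i: "i \<in> L" "coversV i x" using coveringD[OF L(2)] x by meson
  note [simp] = D(1,2)[OF i(1)] D(1,2)[OF j] x
  have xi: "J x (fst i) \<le> J x x + 2 * \<epsilon>" "J (fst i) (fst i) \<le> J x x"
    using i by (auto simp: coversV_def)
  have ij: "i \<in> L - {j}" using i xi D(4)[OF i(1)] expensive by auto
  have xj: "J (fst j) x \<le> J x x + 2 * \<epsilon>"
    using nearest[OF i(1)] xi A.commute[of x "fst j"] by simp
  have fj: "J x x < J (fst j) (fst j)"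
    using D(4)[OF j] expensive by simp
  have Jji: "J (fst j) (fst i) \<le> J x x + 2 * \<epsilon>"
    using A.ultra_le[of "fst j" x "fst i"] xi xj by simp
  have Kji: "K (snd j) (snd i) \<le> K (snd j) (snd j) + 2 * \<epsilon>"
    using D(6)[OF j i(1)] Jji expensive by linarith
  show ?thesis
  proof (cases "\<forall>y\<in>W. \<exists>p\<in>L - {j}. coversW p y")
    case True
    have "\<exists>p\<in>L - {j}. coversV p z" if "z \<in> V" for z
    proof -
      obtain p where p: "p \<in> L" "coversV p z" using coveringD(1)[OF L(2) \<open>z \<in> V\<close>] by blast
      have "coversV i z" if "p = j"
        using p that A.ultra_le[of z "fst j" "fst i" "J z z + 2 * \<epsilon>"] \<open>z \<in> V\<close> Jji fj xi
        by (auto simp: coversV_def)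
      then show ?thesis using p ij by blast
    qed
    then show ?thesis using True by (simp add: covering_def)
  next
    case False
    define Y where "Y = {y \<in> W. \<forall>p\<in>L - {j}. \<not> coversW p y}"
    have "finite Y" "Y \<noteq> {}" using B.finite_carrier False by (auto simp: Y_def)
    then obtain y where y: "y \<in> Y" "\<And>z. z \<in> Y \<Longrightarrow> K y y \<le> K z z"
      using ex_minimizer[of Y "\<lambda>y. K y y"] by blast
    have [simp]: "y \<in> W" using y by (simp add: Y_def)
    have only_j: "\<not> coversW p y" if "p \<in> L" "p \<noteq> j" for p
      using y that by (auto simp: Y_def)
    have "coversW j y" using coveringD(2)[OF L(2) \<open>y \<in> W\<close>] only_j by metis
    then have yj: "J (fst j) (fst j) \<le> K y y + \<epsilon>" "K y (snd j) \<le> K y y + 2 * \<epsilon>"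
      by (auto simp: coversW_def)
    have y_lt: "K y y < K (snd j) (snd j)"
    proof (rule ccontr)
      assume "\<not> K y y < K (snd j) (snd j)"
      then have "K y (snd i) \<le> K y y + 2 * \<epsilon>"
        using B.ultra_le[of y "snd j" "snd i"] yj Kji by simp
      then have "coversW i y" using xi fj yj by (simp add: coversW_def)
      then show False using only_j ij by blast
    qed
    define L' where "L' = {k \<in> L. K y y + 2 * \<epsilon> < K y (snd k)}"
    let ?L = "insert (fst j, y) L'"
    have sub: "L' \<subseteq> L - {j}" using yj by (auto simp: L'_def)
    \<comment> \<open>The \<open>w\<close> of \<open>j\<close> merges with \<open>y\<close> earlier than the \<open>w\<close> of \<open>k\<close> does.\<close>
    have far: "K y (snd k) = K (snd j) (snd k)" if k: "k \<in> L'" for k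
    proof (rule antisym)
      have k': "k \<in> L" "K y y + 2 * \<epsilon> < K y (snd k)" using k by (auto simp: L'_def)
      note [simp] = D(2)[OF k'(1)]
      show "K y (snd k) \<le> K (snd j) (snd k)"
        using B.ultra[of y "snd j" "snd k"] yj k' by simp
      show "K (snd j) (snd k) \<le> K y (snd k)"
        using B.ultra[of "snd j" y "snd k"] B.commute[of y "snd j"] yj k' by simp
    qed
    have near: "K y y + \<epsilon> < J (fst p) (fst p)" "K (snd p) y \<le> K y y + 2 * \<epsilon>"
      if "p \<in> L" "p \<notin> L'" "p \<noteq> j" for p
    proof -
      note [simp] = D(2)[OF that(1)]
      show "K (snd p) y \<le> K y y + 2 * \<epsilon>"
        using that B.commute[of y "snd p"] by (simp add: L'_def)
      then show "K y y + \<epsilon> < J (fst p) (fst p)"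
        using only_j[OF that(1,3)] B.commute[of y "snd p"] by (simp add: coversW_def)
    qed
    have new: "(fst j, y) \<notin> L'"
      using eps_nonneg by (auto simp: L'_def)
    have "matching ?L"
    proof -
      have L'm: "matching L'" using sub L(1) matching_subset by blast
      have self: "\<bar>J (fst j) (fst j) - K y y\<bar> \<le> \<epsilon>"
        using yj y_lt D(4)[OF j] by linarith
      have cross: "\<bar>J (fst j) (fst k) - K y (snd k)\<bar> \<le> \<epsilon>" "\<bar>J (fst k) (fst j) - K (snd k) y\<bar> \<le> \<epsilon>"
        "J (fst j) (fst j) < J (fst j) (fst k)" "K y y < K y (snd k)"
        "J (fst k) (fst k) < J (fst k) (fst j)" "K (snd k) (snd k) < K (snd k) y" if k: "k \<in> L'" for k
      proof -
        have k': "k \<in> L" "k \<noteq> j" "K y y + 2 * \<epsilon> < K y (snd k)" using k sub by (auto simp: L'_def)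
        note [simp] = D(1,2)[OF k'(1)]
        have sep: "J (fst j) (fst j) < J (fst j) (fst k)" "J (fst k) (fst k) < J (fst k) (fst j)"
          "K (snd k) (snd k) < K (snd k) (snd j)"
          using L(1) k' j by (auto simp: matching_def)
        have eq: "K (snd k) y = K (snd k) (snd j)"
          using far[OF k] B.commute[of "snd k" y] B.commute[of "snd k" "snd j"] by simp
        show "J (fst j) (fst j) < J (fst j) (fst k)" "J (fst k) (fst k) < J (fst k) (fst j)"
          "K (snd k) (snd k) < K (snd k) y" using sep eq by auto
        show "K y y < K y (snd k)" using k' eps_nonneg by simp
        show "\<bar>J (fst j) (fst k) - K y (snd k)\<bar> \<le> \<epsilon>"
          using D(5)[OF j k'(1)] D(6)[OF j k'(1)] far[OF k] by (simp add: abs_le_iff)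
        show "\<bar>J (fst k) (fst j) - K (snd k) y\<bar> \<le> \<epsilon>"
          using D(5)[OF k'(1) j] D(6)[OF k'(1) j] eq by (simp add: abs_le_iff)
      qed
      show ?thesis
        using L'm self cross unfolding matching_def by simp
    qed
    moreover have "\<exists>p\<in>?L. coversV p z" if z: "z \<in> V" for z
    proof -
      obtain p where p: "p \<in> L" "coversV p z" using coveringD[OF L(2)] z by meson
      consider "p \<in> L'" | "p = j" | "p \<notin> L'" "p \<noteq> j" by blast
      then show ?thesis
      proof cases
        case 1
        then show ?thesis using p by blast
      next
        case 2
        then have "coversV (fst j, y) z" using p by (simp add: coversV_def)
        then show ?thesis by blast
      next
        case 3
        note [simp] = D(1,2)[OF p(1)] z
        have "K (snd p) (snd j) \<le> K y y + 2 * \<epsilon>"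
          using B.ultra_le[of "snd p" y "snd j"] near[OF p(1) 3] yj by simp
        then have "J (fst p) (fst j) \<le> J (fst p) (fst p) + 2 * \<epsilon>"
          using D(5)[OF p(1) j] near[OF p(1) 3] by linarith
        then have "coversV (fst j, y) z"
          using p(2) A.ultra_le[of z "fst p" "fst j" "J z z + 2 * \<epsilon>"] near[OF p(1) 3] yj
          by (simp add: coversV_def)
        then show ?thesis by blast
      qed
    qed
    moreover have "\<exists>p\<in>?L. coversW p z" if z: "z \<in> W" for z
    proof (cases "K y y \<le> K z z")
      case True
      obtain p where p: "p \<in> L" "coversW p z" using coveringD[OF L(2)] z by meson
      note [simp] = D(1,2)[OF p(1)] z
      show ?thesis
      proof (cases "p \<in> L'")
        case False
        then have "K (snd p) y \<le> K y y + 2 * \<epsilon>"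
          using p B.commute[of y "snd p"] by (simp add: L'_def)
        then have "coversW (fst j, y) z"
          using True p yj B.ultra_le[of z "snd p" y "K z z + 2 * \<epsilon>"] by (simp add: coversW_def)
        then show ?thesis by blast
      qed (use p in blast)
    next
      case False
      then have "z \<notin> Y" using y by auto
      then obtain p where p: "p \<in> L" "p \<noteq> j" "coversW p z" using z by (auto simp: Y_def)
      then have "p \<in> L'" using near(1)[OF p(1) _ p(2)] False unfolding coversW_def by linarith
      then show ?thesis using p by blast
    qed
    ultimately have "matching ?L \<and> covering ?L" by (simp add: covering_def)
    then show ?thesis using \<open>y \<in> W\<close> sub y_lt new by blast
  qed
qed

text \<open>The weight counts the heights of the \<open>w\<close> from a level \<open>c\<close> below all of them, so that both dropping a
  pair and lowering a \<open>w\<close> decrease it.\<close>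

theorem ex_nearest_cheap:
  assumes "matching L0" "covering L0"
  obtains L where "matching L" "nearest_cheap L"
proof -
  have fin: "finite L" if "matching L" for L
    using that A.finite_carrier B.finite_carrier by (auto simp: matching_def intro: finite_subset)
  define c where "c = Min ((\<lambda>y. K y y) ` W) - 1"
  have c: "c < K y y" if "y \<in> W" for y
  proof -
    have "Min ((\<lambda>y. K y y) ` W) \<le> K y y" using B.finite_carrier that by auto
    then show ?thesis by (simp add: c_def)
  qed
  define \<mu> where "\<mu> L = (\<Sum>p\<in>L. K (snd p) (snd p) - c)" for L :: "('a \<times> 'b) set"
  define \<L> where "\<L> = {L. matching L \<and> covering L}"
  have "\<L> \<subseteq> Pow (V \<times> W)" by (auto simp: \<L>_def matching_def)
  then have "finite \<L>"
    using A.finite_carrier B.finite_carrier by (simp add: finite_subset)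
  moreover have "\<L> \<noteq> {}" using assms by (auto simp: \<L>_def)
  ultimately obtain L where L: "L \<in> \<L>" and min: "\<And>L'. L' \<in> \<L> \<Longrightarrow> \<mu> L \<le> \<mu> L'"
    using ex_minimizer[of \<L> \<mu>] by blast
  have m: "matching L" "covering L" "finite L" using L fin by (auto simp: \<L>_def)
  have pos: "0 < K (snd p) (snd p) - c" if "p \<in> L" for p
    using c matchingD(2)[OF m(1) that] by fastforce
  have mono: "\<mu> L' \<le> \<mu> L - (K (snd j) (snd j) - c)" if "L' \<subseteq> L - {j}" "j \<in> L" for L' j
  proof -
    have "\<mu> L' \<le> \<mu> (L - {j})"
      unfolding \<mu>_def by (rule sum_mono2) (use m that pos in \<open>auto simp: less_imp_le\<close>)
    then show ?thesis using m that by (simp add: \<mu>_def sum_diff1)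
  qed
  have no_drop: "\<not> covering (L - {j})" if "j \<in> L" for j
    using mono[of "L - {j}" j] min[of "L - {j}"] pos[OF that] that matching_subset[OF m(1), of "L - {j}"]
    by (auto simp: \<L>_def)
  have "\<exists>p\<in>L. (\<forall>q\<in>L. J x (fst p) \<le> J x (fst q)) \<and> J x (fst p) \<le> J x x + 2 * \<epsilon> \<and>
      K (snd p) (snd p) \<le> J x x + \<epsilon>" if x: "x \<in> V" for x
  proof -
    obtain i where i: "i \<in> L" "coversV i x" using coveringD[OF m(2)] x by meson
    then obtain j where j: "j \<in> L" "\<And>q. q \<in> L \<Longrightarrow> J x (fst j) \<le> J x (fst q)"
      using ex_minimizer[OF m(3), of "\<lambda>p. J x (fst p)"] by blast
    have "K (snd j) (snd j) \<le> J x x + \<epsilon>"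
    proof (rule ccontr)
      assume "\<not> K (snd j) (snd j) \<le> J x x + \<epsilon>"
      then obtain y L' where y: "y \<in> W" "L' \<subseteq> L - {j}" "K y y < K (snd j) (snd j)" "(fst j, y) \<notin> L'"
        "matching (insert (fst j, y) L')" "covering (insert (fst j, y) L')"
        using improve_pair_V[OF m(1,2) x j] no_drop[OF j(1)] by (auto simp: not_le)
      have "finite L'" using y(2) m(3) finite_subset by blast
      then have "\<mu> (insert (fst j, y) L') = \<mu> L' + (K y y - c)" using y(4) by (simp add: \<mu>_def)
      then have "\<mu> (insert (fst j, y) L') < \<mu> L" using mono[OF y(2) j(1)] y(3) by simp
      then show False using min[of "insert (fst j, y) L'"] y by (simp add: \<L>_def)
    qed
    moreover have "J x (fst j) \<le> J x x + 2 * \<epsilon>" using i j(2)[OF i(1)] by (simp add: coversV_def)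
    ultimately show ?thesis using j by blast
  qed
  moreover have "\<exists>p\<in>L. (\<forall>q\<in>L. K y (snd p) \<le> K y (snd q)) \<and> K y (snd p) \<le> K y y + 2 * \<epsilon> \<and>
      J (fst p) (fst p) \<le> K y y + \<epsilon>" if y: "y \<in> W" for y
  proof -
    obtain i where i: "i \<in> L" "coversW i y" using coveringD[OF m(2)] y by meson
    then obtain j where j: "j \<in> L" "\<And>q. q \<in> L \<Longrightarrow> K y (snd j) \<le> K y (snd q)"
      using ex_minimizer[OF m(3), of "\<lambda>p. K y (snd p)"] by blast
    have "J (fst j) (fst j) \<le> K y y + \<epsilon>"
      using drop_pair_W[OF m(1,2) y j] no_drop[OF j(1)] by force
    moreover have "K y (snd j) \<le> K y y + 2 * \<epsilon>" using i j(2)[OF i(1)] by (simp add: coversW_def)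
    ultimately show ?thesis using j by blast
  qed
  ultimately have "nearest_cheap L" by (simp add: nearest_cheap_def)
  then show ?thesis using that m by blast
qed

end

section \<open>From compatible maps to a covering matching\<close>

context merge_tree
begin

lemma ultrametric_merge_height: "ultrametric (verts T) (merge_height T)"
proof
  show "merge_height T x x \<le> merge_height T x y" if "x \<in> verts T" "y \<in> verts T" for x y
    using that merge_height_ge merge_height_self by simp
qed (use finite_verts merge_height_commute merge_height_ultra in auto)

lemma merge_height_gt:
  assumes "u \<in> verts T" "v \<in> verts T" "\<not> tle T v u"
  shows "height T u < merge_height T u v"
  using tle_of_merge_height[OF assms(1,2), of u] assms(3) by force

lemma merge_height_le_mheight:
  assumes "u \<in> verts T" "v \<in> verts T" "mle T (vpoint T u) x" "mle T (vpoint T v) x"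
  shows "merge_height T u v \<le> mheight x"
proof -
  have "x \<in> mpoints T" using assms mle_in2 by blast
  then show ?thesis
    using assms merge_height_le[of u v "fst x"] mpointD[of x] by (auto simp: mle_vpoint_iff)
qed

end

locale order_interleaving = T: merge_tree T + G: merge_tree G
  for T :: "'a mtree" and G :: "'b mtree" +
  fixes \<epsilon> :: real and \<alpha> :: "'a mpoint \<Rightarrow> 'b mpoint" and \<beta> :: "'b mpoint \<Rightarrow> 'a mpoint"
  assumes eps: "0 \<le> \<epsilon>"
    and \<alpha>_in: "x \<in> mpoints T \<Longrightarrow> \<alpha> x \<in> mpoints G"
    and \<beta>_in: "y \<in> mpoints G \<Longrightarrow> \<beta> y \<in> mpoints T"
    and \<alpha>_height: "x \<in> mpoints T \<Longrightarrow> mheight (\<alpha> x) = mheight x + \<epsilon>"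
    and \<beta>_height: "y \<in> mpoints G \<Longrightarrow> mheight (\<beta> y) = mheight y + \<epsilon>"
    and \<alpha>_mono: "mle T x x' \<Longrightarrow> mle G (\<alpha> x) (\<alpha> x')"
    and \<beta>_mono: "mle G y y' \<Longrightarrow> mle T (\<beta> y) (\<beta> y')"
    and \<beta>\<alpha>: "x \<in> mpoints T \<Longrightarrow> mle T x (\<beta> (\<alpha> x))"
    and \<alpha>\<beta>: "y \<in> mpoints G \<Longrightarrow> mle G y (\<alpha> (\<beta> y))"

lemma order_interleaving_if_compatible:
  assumes "merge_tree T" "merge_tree G" "0 \<le> \<epsilon>" "compatible_maps T G \<epsilon> \<alpha> \<beta>"
  shows "order_interleaving T G \<epsilon> \<alpha> \<beta>"
proof -
  interpret T: merge_tree T by fact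
  interpret G: merge_tree G by fact
  note c = assms(4)[unfolded compatible_maps_def]
  show ?thesis
  proof
    show "mle G (\<alpha> x) (\<alpha> x')" if "mle T x x'" for x x'
      using mono_if_continuous_map_mtop[OF assms(1,2)] c that by blast
    show "mle T (\<beta> y) (\<beta> y')" if "mle G y y'" for y y'
      using mono_if_continuous_map_mtop[OF assms(2,1)] c that by blast
    show "mle T x (\<beta> (\<alpha> x))" if "x \<in> mpoints T" for x
      using c that assms(3) T.mle_point_above by (simp add: shift_def)
    show "mle G y (\<alpha> (\<beta> y))" if "y \<in> mpoints G" for y
      using c that assms(3) G.mle_point_above by (simp add: shift_def)
  qed (use c assms(3) in \<open>auto simp: Pi_iff\<close>)
qed

context order_interleaving
begin

sublocale ultrametric_pair "verts T" "merge_height T" "verts G" "merge_height G" \<epsilon>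
  using T.ultrametric_merge_height G.ultrametric_merge_height eps
  by (simp add: ultrametric_pair_def ultrametric_pair_axioms_def)

definition vertex_image :: "'a \<Rightarrow> 'b mpoint" where
  "vertex_image v = \<alpha> (vpoint T v)"

text \<open>Distinct vertices have distinct images, because their images have distinct heights. So minimality of
  an image may be phrased through its vertex.\<close>

definition minimal_verts :: "'a set" where
  "minimal_verts = {v \<in> verts T. \<forall>u\<in>verts T. mle G (vertex_image u) (vertex_image v) \<longrightarrow> u = v}"

definition lowest_pairs :: "('a \<times> 'b) set" where
  "lowest_pairs = (\<lambda>v. (v, fst (vertex_image v))) ` minimal_verts"

lemma vertex_image_in: "v \<in> verts T \<Longrightarrow> vertex_image v \<in> mpoints G"
  and vertex_image_height: "v \<in> verts T \<Longrightarrow> mheight (vertex_image v) = height T v + \<epsilon>"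
  and fst_vertex_image_in: "v \<in> verts T \<Longrightarrow> fst (vertex_image v) \<in> verts G"
  and fst_vertex_image_le: "v \<in> verts T \<Longrightarrow> mle G (vpoint G (fst (vertex_image v))) (vertex_image v)"
  unfolding vertex_image_def using \<alpha>_in \<alpha>_height G.mpointD G.mle_vpoint_fst by auto

lemma vertex_image_mono: "u \<in> verts T \<Longrightarrow> v \<in> verts T \<Longrightarrow> tle T u v \<Longrightarrow> mle G (vertex_image u) (vertex_image v)"
  unfolding vertex_image_def by (rule \<alpha>_mono) (simp add: T.mle_vpoint_iff)

lemma vpoint_le_\<beta>_if: "v \<in> verts T \<Longrightarrow> mle G (vertex_image v) y \<Longrightarrow> mle T (vpoint T v) (\<beta> y)"
  unfolding vertex_image_def using \<beta>\<alpha> \<beta>_mono T.mle_trans T.vpoint_in by blast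

lemma vertex_image_fst_le: "x \<in> mpoints T \<Longrightarrow> mle G (vertex_image (fst x)) (\<alpha> x)"
  unfolding vertex_image_def using \<alpha>_mono T.mle_vpoint_fst by blast

lemma minimal_vertsD: "v \<in> minimal_verts \<Longrightarrow> v \<in> verts T"
  by (simp add: minimal_verts_def)

lemma minimal_verts_antichain:
  "v \<in> minimal_verts \<Longrightarrow> u \<in> verts T \<Longrightarrow> mle G (vertex_image u) (vertex_image v) \<Longrightarrow> u = v"
  by (simp add: minimal_verts_def)

lemma ex_minimal:
  assumes "x \<in> verts T"
  obtains v where "v \<in> minimal_verts" "mle G (vertex_image v) (vertex_image x)"
proof -
  define U where "U = {u \<in> verts T. mle G (vertex_image u) (vertex_image x)}"
  have "finite U" "x \<in> U" using T.finite_verts assms vertex_image_in by (auto simp: U_def)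
  then obtain v where v: "v \<in> U" "\<And>u. u \<in> U \<Longrightarrow> height T v \<le> height T u"
    using ex_minimizer[of U "height T"] by blast
  have "u = v" if "u \<in> verts T" "mle G (vertex_image u) (vertex_image v)" for u
  proof -
    have "u \<in> U" using that v(1) G.mle_trans by (auto simp: U_def)
    then have "height T v \<le> height T u" using v by blast
    moreover have "height T u \<le> height T v"
      using G.mle_mheight[OF that(2)] vertex_image_height that(1) v(1) by (auto simp: U_def)
    ultimately show ?thesis
      using T.height_inj that(1) v(1) by (auto simp: U_def dest: inj_onD)
  qed
  then show ?thesis using that[of v] v(1) by (auto simp: minimal_verts_def U_def)
qed

text \<open>The point \<open>z\<close> is the round trip of \<open>y\<close>: it lies above the image of the vertex just below \<open>\<beta> y\<close>, and
  so above a minimal image.\<close>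

lemma ex_minimal_above:
  assumes "y \<in> verts G"
  obtains v z where "v \<in> minimal_verts" "mle G (vertex_image v) z" "mle G (vpoint G y) z"
    "mheight z = height G y + 2 * \<epsilon>" "height T v \<le> height G y + \<epsilon>"
proof -
  define x where "x = \<beta> (vpoint G y)"
  have x: "x \<in> mpoints T" "mheight x = height G y + \<epsilon>"
    using assms \<beta>_in \<beta>_height by (auto simp: x_def)
  have v: "fst x \<in> verts T" "height T (fst x) \<le> mheight x" using T.mpointD[OF x(1)] by auto
  obtain v where m: "v \<in> minimal_verts" "mle G (vertex_image v) (vertex_image (fst x))"
    using ex_minimal[OF v(1)] by blast
  have "height T v \<le> height T (fst x)"
    using G.mle_mheight[OF m(2)] vertex_image_height minimal_vertsD m(1) v by simp
  moreover have "mle G (vertex_image v) (\<alpha> x)"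
    using m(2) vertex_image_fst_le[OF x(1)] G.mle_trans by blast
  moreover have "mle G (vpoint G y) (\<alpha> x)"
    unfolding x_def using \<alpha>\<beta> assms by simp
  moreover have "mheight (\<alpha> x) = height G y + 2 * \<epsilon>" using \<alpha>_height x by simp
  ultimately show ?thesis using that[of v "\<alpha> x"] m(1) v x by simp
qed

text \<open>Minimality bounds \<open>f(v)\<close> by \<open>g(w) + \<epsilon>\<close>: otherwise the image of \<open>v\<close> would lie above the round trip of \<open>w\<close>,
  hence above another minimal image. Two minimal images are incomparable, so every common ancestor
  of the vertices below them is above both, and \<open>\<beta>\<close> carries it above both \<open>v\<close> and \<open>v'\<close>.\<close>

lemma matching_lowest_pairs: "matching lowest_pairs"
proof -
  have self: "\<bar>height T v - height G (fst (vertex_image v))\<bar> \<le> \<epsilon>" if v: "v \<in> minimal_verts" for v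
  proof -
    note vT = minimal_vertsD[OF v]
    let ?w = "fst (vertex_image v)"
    have "height G ?w \<le> height T v + \<epsilon>"
      using G.mle_mheight[OF fst_vertex_image_le[OF vT]] vertex_image_height[OF vT] by simp
    moreover have "height T v \<le> height G ?w + \<epsilon>"
    proof (rule ccontr)
      assume c: "\<not> height T v \<le> height G ?w + \<epsilon>"
      obtain u z where u: "u \<in> minimal_verts" "mle G (vertex_image u) z" "mle G (vpoint G ?w) z"
        "mheight z = height G ?w + 2 * \<epsilon>" "height T u \<le> height G ?w + \<epsilon>"
        using ex_minimal_above[OF fst_vertex_image_in[OF vT]] by blast
      have "mle G z (vertex_image v)"
        using G.mle_chain[OF u(3) fst_vertex_image_le[OF vT]] u(4) vertex_image_height[OF vT] c by simp
      then have "u = v"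
        using minimal_verts_antichain[OF v minimal_vertsD[OF u(1)]] G.mle_trans u(2) by blast
      then show False using u(5) c by simp
    qed
    ultimately show ?thesis by linarith
  qed
  have cross: "\<bar>merge_height T v v' - merge_height G (fst (vertex_image v)) (fst (vertex_image v'))\<bar> \<le> \<epsilon>"
    "height T v < merge_height T v v'"
    "height G (fst (vertex_image v)) < merge_height G (fst (vertex_image v)) (fst (vertex_image v'))"
    if v: "v \<in> minimal_verts" "v' \<in> minimal_verts" "v \<noteq> v'" for v v'
  proof -
    note [simp] = minimal_vertsD[OF v(1)] minimal_vertsD[OF v(2)]
    let ?w = "fst (vertex_image v)" and ?w' = "fst (vertex_image v')"
    have [simp]: "?w \<in> verts G" "?w' \<in> verts G" by (simp_all add: fst_vertex_image_in)
    have inc: "\<not> mle G (vertex_image v) (vertex_image v')" "\<not> mle G (vertex_image v') (vertex_image v)"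
      using minimal_verts_antichain[OF v(1), of v'] minimal_verts_antichain[OF v(2), of v] v(3) by auto
    have below: "\<not> (mle G (vpoint G ?w') (vertex_image v) \<and> mle G (vpoint G ?w') (vertex_image v'))"
      "\<not> (mle G (vpoint G ?w) (vertex_image v) \<and> mle G (vpoint G ?w) (vertex_image v'))"
      using inc G.mle_chain by (meson linear)+
    have inc_w: "\<not> tle G ?w' ?w"
    proof
      assume "tle G ?w' ?w"
      then have "mle G (vpoint G ?w') (vpoint G ?w)" by (simp add: G.mle_vpoint_iff)
      then have "mle G (vpoint G ?w') (vertex_image v)" using G.mle_trans[OF _ fst_vertex_image_le[of v]] by simp
      then show False using below fst_vertex_image_le[of v'] by simp
    qed
    then show "height G ?w < merge_height G ?w ?w'" using G.merge_height_gt by simp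
    have "\<not> tle T v' v" using vertex_image_mono[of v' v] inc by auto
    then show "height T v < merge_height T v v'" using T.merge_height_gt by simp
    define m where "m = LCA T {v, v'}"
    have m: "m \<in> verts T" "tle T v m" "tle T v' m" "height T m = merge_height T v v'"
      unfolding m_def by (auto simp: merge_height_def intro!: T.LCA_in_verts T.LCA_upper)
    have "mle G (vpoint G ?w) (vertex_image m)" "mle G (vpoint G ?w') (vertex_image m)"
      using fst_vertex_image_le vertex_image_mono m G.mle_trans minimal_vertsD v by blast+
    then have "merge_height G ?w ?w' \<le> merge_height T v v' + \<epsilon>"
      using G.merge_height_le_mheight[of ?w ?w' "vertex_image m"] vertex_image_height m by simp
    moreover define n where "n = LCA G {?w, ?w'}"
    have n: "n \<in> verts G" "tle G ?w n" "tle G ?w' n" "height G n = merge_height G ?w ?w'"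
      unfolding n_def by (auto simp: merge_height_def intro!: G.LCA_in_verts G.LCA_upper)
    have wn: "mle G (vpoint G ?w) (vpoint G n)" "mle G (vpoint G ?w') (vpoint G n)"
      using n by (simp_all add: G.mle_vpoint_iff)
    have "\<not> mle G (vpoint G n) (vertex_image v)" "\<not> mle G (vpoint G n) (vertex_image v')"
      using below wn fst_vertex_image_le[of v] fst_vertex_image_le[of v'] G.mle_trans minimal_vertsD v by blast+
    then have "mle G (vertex_image v) (vpoint G n)" "mle G (vertex_image v') (vpoint G n)"
      using G.mle_chain wn fst_vertex_image_le[of v] fst_vertex_image_le[of v'] minimal_vertsD v by (meson linear)+
    then have "mle T (vpoint T v) (\<beta> (vpoint G n))" "mle T (vpoint T v') (\<beta> (vpoint G n))"
      using vpoint_le_\<beta>_if by auto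
    then have "merge_height T v v' \<le> merge_height G ?w ?w' + \<epsilon>"
      using T.merge_height_le_mheight[of v v' "\<beta> (vpoint G n)"] \<beta>_height n by simp
    ultimately show "\<bar>merge_height T v v' - merge_height G ?w ?w'\<bar> \<le> \<epsilon>" by linarith
  qed
  show ?thesis
    unfolding matching_def
  proof (intro conjI ballI impI)
    show "lowest_pairs \<subseteq> verts T \<times> verts G"
      using minimal_vertsD fst_vertex_image_in by (auto simp: lowest_pairs_def)
    fix p q assume "p \<in> lowest_pairs" "q \<in> lowest_pairs"
    then obtain v v' where v: "v \<in> minimal_verts" "v' \<in> minimal_verts"
      "p = (v, fst (vertex_image v))" "q = (v', fst (vertex_image v'))"
      by (auto simp: lowest_pairs_def)
    note [simp] = minimal_vertsD[OF v(1)] minimal_vertsD[OF v(2)]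
    show "\<bar>merge_height T (fst p) (fst q) - merge_height G (snd p) (snd q)\<bar> \<le> \<epsilon>"
      using self[OF v(1)] cross(1)[OF v(1,2)] v fst_vertex_image_in[of v]
      by (cases "v = v'") (simp_all add: T.merge_height_self G.merge_height_self)
    assume "p \<noteq> q"
    then have "v \<noteq> v'" using v by auto
    then show "merge_height T (fst p) (fst p) < merge_height T (fst p) (fst q)"
      "merge_height G (snd p) (snd p) < merge_height G (snd p) (snd q)"
      using cross(2,3)[OF v(1,2)] v fst_vertex_image_in[of v]
      by (simp_all add: T.merge_height_self G.merge_height_self)
  qed
qed

lemma covering_lowest_pairs: "covering lowest_pairs"
  unfolding covering_def
proof (intro conjI ballI)
  fix x assume x: "x \<in> verts T"
  obtain v where v: "v \<in> minimal_verts" "mle G (vertex_image v) (vertex_image x)"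
    using ex_minimal[OF x] by blast
  note vT = minimal_vertsD[OF v(1)]
  have "merge_height T x v \<le> mheight (\<beta> (vertex_image x))"
    using vpoint_le_\<beta>_if[OF x, of "vertex_image x"] vpoint_le_\<beta>_if[OF vT v(2)] x vT vertex_image_in
    by (intro T.merge_height_le_mheight) auto
  moreover have "mheight (\<beta> (vertex_image x)) = height T x + 2 * \<epsilon>"
    using \<beta>_height vertex_image_in vertex_image_height x by simp
  moreover have "height T v \<le> height T x"
    using G.mle_mheight[OF v(2)] vertex_image_height x vT by simp
  ultimately have "coversV (v, fst (vertex_image v)) x"
    using x vT by (simp add: coversV_def T.merge_height_self)
  then show "\<exists>p\<in>lowest_pairs. coversV p x" using v(1) by (auto simp: lowest_pairs_def)
next
  fix y assume y: "y \<in> verts G"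
  obtain v z where v: "v \<in> minimal_verts" "mle G (vertex_image v) z" "mle G (vpoint G y) z"
    "mheight z = height G y + 2 * \<epsilon>" "height T v \<le> height G y + \<epsilon>"
    using ex_minimal_above[OF y] by blast
  note vT = minimal_vertsD[OF v(1)]
  have "mle G (vpoint G (fst (vertex_image v))) z" using fst_vertex_image_le[OF vT] v(2) G.mle_trans by blast
  then have "merge_height G y (fst (vertex_image v)) \<le> mheight z"
    using v(3) y fst_vertex_image_in[OF vT] by (intro G.merge_height_le_mheight) auto
  then have "coversW (v, fst (vertex_image v)) y"
    using v y vT by (simp add: coversW_def T.merge_height_self G.merge_height_self)
  then show "\<exists>p\<in>lowest_pairs. coversW p y" using v(1) by (auto simp: lowest_pairs_def)
qed

end

section \<open>From a matching to a coupling\<close>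

text \<open>The pairs below some vertex of \<open>T\<close> are also the pairs below the least common ancestor of their
  first components, so a set of pairs is cut out by a vertex of \<open>T\<close> iff it is cut out by that
  ancestor.\<close>

definition common_cluster :: "'a mtree \<Rightarrow> 'b mtree \<Rightarrow> ('a \<times> 'b) set \<Rightarrow> ('a \<times> 'b) set \<Rightarrow> bool" where
  "common_cluster T G L I \<longleftrightarrow> I \<subseteq> L \<and> I \<noteq> {} \<and>
     (\<forall>(v, w)\<in>L. tle T v (LCA T (fst ` I)) \<longrightarrow> (v, w) \<in> I) \<and>
     (\<forall>(v, w)\<in>L. tle G w (LCA G (snd ` I)) \<longrightarrow> (v, w) \<in> I)"

definition cluster_coupling :: "'a mtree \<Rightarrow> 'b mtree \<Rightarrow> ('a \<times> 'b) set \<Rightarrow> ('a \<times> 'b) set" where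
  "cluster_coupling T G L = (\<lambda>I. (LCA T (fst ` I), LCA G (snd ` I))) ` {I. common_cluster T G L I}"

lemma fst_converse_image: "fst ` (R\<inverse>) = snd ` R"
  and snd_converse_image: "snd ` (R\<inverse>) = fst ` R"
  by force+

lemma common_cluster_converse: "common_cluster T G L I \<Longrightarrow> common_cluster G T (L\<inverse>) (I\<inverse>)"
  unfolding common_cluster_def fst_converse_image snd_converse_image by auto

lemma cluster_coupling_converse: "cluster_coupling G T (L\<inverse>) = (cluster_coupling T G L)\<inverse>"
proof -
  have sub: "(cluster_coupling T G L)\<inverse> \<subseteq> cluster_coupling G T (L\<inverse>)"
    for T :: "'x mtree" and G :: "'y mtree" and L
  proof
    fix p assume "p \<in> (cluster_coupling T G L)\<inverse>"
    then obtain I where I: "common_cluster T G L I" "p = (LCA G (snd ` I), LCA T (fst ` I))"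
      by (auto simp: cluster_coupling_def)
    then have "p = (LCA G (fst ` (I\<inverse>)), LCA T (snd ` (I\<inverse>)))"
      by (simp add: fst_converse_image snd_converse_image)
    then show "p \<in> cluster_coupling G T (L\<inverse>)"
      unfolding cluster_coupling_def using common_cluster_converse[OF I(1)] by blast
  qed
  have "cluster_coupling G T (L\<inverse>) \<subseteq> (cluster_coupling T G L)\<inverse>"
    using sub[of G T "L\<inverse>"] by auto
  then show ?thesis using sub by blast
qed

locale tree_matching = T: merge_tree T + G: merge_tree G
  for T :: "'a mtree" and G :: "'b mtree" +
  fixes L :: "('a \<times> 'b) set" and \<epsilon> :: real
  assumes pair_verts: "(v, w) \<in> L \<Longrightarrow> v \<in> verts T \<and> w \<in> verts G"
    and nonempty: "L \<noteq> {}"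
    and antichain_T: "(v, w) \<in> L \<Longrightarrow> (v', w') \<in> L \<Longrightarrow> tle T v v' \<Longrightarrow> (v, w) = (v', w')"
    and antichain_G: "(v, w) \<in> L \<Longrightarrow> (v', w') \<in> L \<Longrightarrow> tle G w w' \<Longrightarrow> (v, w) = (v', w')"
    and dist_T: "(v, w) \<in> L \<Longrightarrow> (v', w') \<in> L \<Longrightarrow> merge_height T v v' \<le> merge_height G w w' + \<epsilon>"
    and dist_G: "(v, w) \<in> L \<Longrightarrow> (v', w') \<in> L \<Longrightarrow> merge_height G w w' \<le> merge_height T v v' + \<epsilon>"
    and nearest_T: "x \<in> verts T \<Longrightarrow> \<exists>v w. (v, w) \<in> L \<and>
      (\<forall>v' w'. (v', w') \<in> L \<longrightarrow> merge_height T x v \<le> merge_height T x v') \<and>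
      merge_height T x v \<le> height T x + 2 * \<epsilon> \<and> height G w \<le> height T x + \<epsilon>"
    and nearest_G: "y \<in> verts G \<Longrightarrow> \<exists>v w. (v, w) \<in> L \<and>
      (\<forall>v' w'. (v', w') \<in> L \<longrightarrow> merge_height G y w \<le> merge_height G y w') \<and>
      merge_height G y w \<le> height G y + 2 * \<epsilon> \<and> height T v \<le> height G y + \<epsilon>"
begin

abbreviation "C \<equiv> cluster_coupling T G L"

lemma tree_matching_converse: "tree_matching G T (L\<inverse>) \<epsilon>"
proof
  show "\<exists>w v. (w, v) \<in> L\<inverse> \<and> (\<forall>w' v'. (w', v') \<in> L\<inverse> \<longrightarrow> merge_height G y w \<le> merge_height G y w') \<and>
      merge_height G y w \<le> height G y + 2 * \<epsilon> \<and> height T v \<le> height G y + \<epsilon>"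
    if "y \<in> verts G" for y
    using nearest_G[OF that] by (simp add: converse_iff) blast
  show "\<exists>w v. (w, v) \<in> L\<inverse> \<and> (\<forall>w' v'. (w', v') \<in> L\<inverse> \<longrightarrow> merge_height T x v \<le> merge_height T x v') \<and>
      merge_height T x v \<le> height T x + 2 * \<epsilon> \<and> height G w \<le> height T x + \<epsilon>"
    if "x \<in> verts T" for x
    using nearest_T[OF that] by (simp add: converse_iff) blast
qed (use pair_verts nonempty antichain_T antichain_G dist_T dist_G in auto)

lemma fst_subset: "I \<subseteq> L \<Longrightarrow> fst ` I \<subseteq> verts T"
  and snd_subset: "I \<subseteq> L \<Longrightarrow> snd ` I \<subseteq> verts G"
  using pair_verts by auto

lemma couplingE:
  assumes "(m, n) \<in> C"
  obtains I where "I \<subseteq> L" "I \<noteq> {}" "m = LCA T (fst ` I)" "n = LCA G (snd ` I)"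
    "\<And>v w. (v, w) \<in> L \<Longrightarrow> (v, w) \<in> I \<longleftrightarrow> tle T v m"
    "\<And>v w. (v, w) \<in> L \<Longrightarrow> (v, w) \<in> I \<longleftrightarrow> tle G w n"
proof -
  obtain I where I: "common_cluster T G L I" "m = LCA T (fst ` I)" "n = LCA G (snd ` I)"
    using assms by (auto simp: cluster_coupling_def)
  then have sub: "I \<subseteq> L" "I \<noteq> {}" by (auto simp: common_cluster_def)
  have "(v, w) \<in> I \<longleftrightarrow> tle T v m" "(v, w) \<in> I \<longleftrightarrow> tle G w n" if "(v, w) \<in> L" for v w
  proof -
    have "tle T v m" "tle G w n" if "(v, w) \<in> I"
      using I(2,3) that T.LCA_upper[OF fst_subset[OF sub(1)], of v]
        G.LCA_upper[OF snd_subset[OF sub(1)], of w] by force+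
    then show "(v, w) \<in> I \<longleftrightarrow> tle T v m" "(v, w) \<in> I \<longleftrightarrow> tle G w n"
      using I that unfolding common_cluster_def by blast+
  qed
  then show ?thesis using that I sub by blast
qed

lemma couplingI:
  assumes "I \<subseteq> L" "I \<noteq> {}"
    "\<And>v w. (v, w) \<in> L \<Longrightarrow> tle T v (LCA T (fst ` I)) \<Longrightarrow> (v, w) \<in> I"
    "\<And>v w. (v, w) \<in> L \<Longrightarrow> tle G w (LCA G (snd ` I)) \<Longrightarrow> (v, w) \<in> I"
  shows "(LCA T (fst ` I), LCA G (snd ` I)) \<in> C"
  unfolding cluster_coupling_def common_cluster_def
  by (rule image_eqI[where x = I]) (use assms in auto)

lemma LCA_fst_least:
  assumes "I \<subseteq> L" "I \<noteq> {}" "u \<in> verts T" "\<And>v w. (v, w) \<in> I \<Longrightarrow> tle T v u"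
  shows "tle T (LCA T (fst ` I)) u"
  using assms fst_subset[OF assms(1)] by (intro T.LCA_least) auto

lemma LCA_snd_least:
  assumes "I \<subseteq> L" "I \<noteq> {}" "u \<in> verts G" "\<And>v w. (v, w) \<in> I \<Longrightarrow> tle G w u"
  shows "tle G (LCA G (snd ` I)) u"
  using assms snd_subset[OF assms(1)] by (intro G.LCA_least) auto

lemma C_verts:
  assumes "(m, n) \<in> C"
  shows "m \<in> verts T \<and> n \<in> verts G"
proof -
  obtain I where "I \<subseteq> L" "I \<noteq> {}" "m = LCA T (fst ` I)" "n = LCA G (snd ` I)"
    using couplingE[OF assms] by metis
  then show ?thesis
    using T.LCA_in_verts[OF fst_subset[of I]] G.LCA_in_verts[OF snd_subset[of I]] by simp
qed

lemma fst_C_verts: "fst ` C \<subseteq> verts T"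
  using C_verts by auto

lemma C_mono:
  assumes "(m, n) \<in> C" "(m', n') \<in> C" "tle T m m'"
  shows "tle G n n'"
proof -
  obtain I where I: "I \<subseteq> L" "I \<noteq> {}" "n = LCA G (snd ` I)"
    "\<And>v w. (v, w) \<in> L \<Longrightarrow> (v, w) \<in> I \<longleftrightarrow> tle T v m"
    using couplingE[OF assms(1)] by metis
  obtain I' where I': "\<And>v w. (v, w) \<in> L \<Longrightarrow> (v, w) \<in> I' \<longleftrightarrow> tle T v m'"
    "\<And>v w. (v, w) \<in> L \<Longrightarrow> (v, w) \<in> I' \<longleftrightarrow> tle G w n'"
    using couplingE[OF assms(2)] by metis
  have "tle G w n'" if "(v, w) \<in> I" for v w
    using that I I' assms(3) by (meson rtrancl_trans subsetD)
  then show ?thesis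
    unfolding I(3) using I C_verts[OF assms(2)] by (intro LCA_snd_least) auto
qed

lemma L_subset_C: "L \<subseteq> C"
proof (rule subrelI)
  fix v w assume vw: "(v, w) \<in> L"
  have eq: "LCA T (fst ` {(v, w)}) = v" "LCA G (snd ` {(v, w)}) = w"
    using pair_verts[OF vw] by (simp_all add: T.LCA_singleton G.LCA_singleton)
  have "(LCA T (fst ` {(v, w)}), LCA G (snd ` {(v, w)})) \<in> C"
  proof (rule couplingI)
    fix v' w' assume L: "(v', w') \<in> L"
    show "(v', w') \<in> {(v, w)}" if "tle T v' (LCA T (fst ` {(v, w)}))"
      using antichain_T[OF L vw] that unfolding eq by blast
    show "(v', w') \<in> {(v, w)}" if "tle G w' (LCA G (snd ` {(v, w)}))"
      using antichain_G[OF L vw] that unfolding eq by blast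
  qed (use vw in auto)
  then show "(v, w) \<in> C" unfolding eq .
qed

lemma pair_below_coupled:
  assumes "m \<in> fst ` C"
  obtains v w where "(v, w) \<in> L" "tle T v m"
proof -
  obtain n where "(m, n) \<in> C" using assms by auto
  then obtain I where "I \<subseteq> L" "I \<noteq> {}" "\<And>v w. (v, w) \<in> L \<Longrightarrow> (v, w) \<in> I \<longleftrightarrow> tle T v m"
    using couplingE by metis
  then show ?thesis using that by (metis equals0I subsetD surj_pair)
qed

text \<open>If \<open>u\<close> were the only maximal coupled vertex below \<open>m\<close>, the whole cluster of \<open>m\<close> would lie below
  \<open>u\<close>, and \<open>m\<close> would not be its least common ancestor.\<close>

lemma Lambda_not_single:
  assumes "m \<in> fst ` C"
  shows "card (Lambda T C m) \<noteq> 1"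
proof
  assume "card (Lambda T C m) = 1"
  then obtain u where u: "Lambda T C m = {u}" by (auto simp: card_1_singleton_iff)
  then have uC: "u \<in> fst ` C" "tless T u m" by (auto simp: Lambda_def)
  obtain n where n: "(m, n) \<in> C" using assms by auto
  then obtain I where I: "I \<subseteq> L" "I \<noteq> {}" "m = LCA T (fst ` I)"
    "\<And>v w. (v, w) \<in> L \<Longrightarrow> (v, w) \<in> I \<longleftrightarrow> tle T v m"
    using couplingE by metis
  have "tle T v u" if vw: "(v, w) \<in> I" for v w
  proof -
    have L: "(v, w) \<in> L" "tle T v m" using I vw by auto
    have "v \<noteq> m"
    proof
      assume "v = m"
      obtain v' w' where v': "(v', w') \<in> L" "tle T v' u" using pair_below_coupled[OF uC(1)] .
      then have "tle T v' v" using uC \<open>v = m\<close> by (simp add: T.tless_iff) (meson rtrancl_trans)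
      then have "v' = v" using antichain_T[OF v'(1) L(1)] by simp
      then show False
        using v' uC \<open>v = m\<close> T.tle_height[of m u] T.height_strict_mono[of u m] by simp
    qed
    then have "tless T v m" using L T.tless_iff by blast
    moreover have "v \<in> fst ` C" using L L_subset_C by force
    ultimately obtain a where "a \<in> Lambda T C m" "tle T v a"
      using T.ex_Lambda[OF fst_C_verts, of v m] by metis
    then show ?thesis using u by simp
  qed
  then have "tle T m u"
    unfolding I(3) using I uC fst_C_verts by (intro LCA_fst_least) auto
  then show False using T.tle_height[of m u] T.height_strict_mono[OF uC(2)] by simp
qed

text \<open>The distortion bound for two pairs extends to any set of pairs below \<open>x\<close>. It is the source of the
  upper bounds in the cost of matched and of branching vertices.\<close>

lemma LCA_partners_bound:
  assumes "I \<subseteq> L" "I \<noteq> {}" "x \<in> verts T" "\<And>v w. (v, w) \<in> I \<Longrightarrow> tle T v x"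
  shows "height G (LCA G (snd ` I)) \<le> height T x + \<epsilon>"
proof -
  obtain v w where vw: "(v, w) \<in> I" using assms(2) by auto
  then have "w \<in> snd ` I" by force
  then obtain b where b: "b \<in> snd ` I" "height G (LCA G (snd ` I)) \<le> merge_height G w b"
    by (rule G.height_LCA_le_pair[OF snd_subset[OF assms(1)]])
  then obtain v' where v': "(v', b) \<in> I" by auto
  have "merge_height G w b \<le> merge_height T v v' + \<epsilon>"
    using dist_G vw v' assms(1) by blast
  moreover have "merge_height T v v' \<le> height T x"
    using T.merge_height_le[of v v' x] assms vw v' pair_verts by blast
  ultimately show ?thesis using b by linarith
qed

lemma matched_height_le:
  assumes "(m, n) \<in> C"
  shows "height G n \<le> height T m + \<epsilon>"
proof -
  obtain I where I: "I \<subseteq> L" "I \<noteq> {}" "n = LCA G (snd ` I)"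
    "\<And>v w. (v, w) \<in> L \<Longrightarrow> (v, w) \<in> I \<longleftrightarrow> tle T v m"
    using couplingE[OF assms] by metis
  then show ?thesis
    using LCA_partners_bound[OF I(1,2)] C_verts[OF assms] by blast
qed

lemma C_mono_iff:
  assumes "(m, n) \<in> C" "(m', n') \<in> C"
  shows "tle T m m' \<longleftrightarrow> tle G n n'" "m = m' \<longleftrightarrow> n = n'"
proof -
  interpret conv: tree_matching G T "L\<inverse>" \<epsilon> by (rule tree_matching_converse)
  have iff: "tle T m m' \<longleftrightarrow> tle G n n'" if "(m, n) \<in> C" "(m', n') \<in> C" for m n m' n'
    using that C_mono conv.C_mono[of n m n' m'] by (auto simp: cluster_coupling_converse)
  show "tle T m m' \<longleftrightarrow> tle G n n'" using iff assms by blast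
  show "m = m' \<longleftrightarrow> n = n'"
    using iff[OF assms] iff[OF assms(2,1)] T.tle_eqI[of m m'] G.tle_eqI[of n n']
      T.tle_height[of m' m] G.tle_height[of n' n] by auto
qed

lemma cluster_coupling_in_couplings: "C \<in> couplings T G"
proof -
  interpret conv: tree_matching G T "L\<inverse>" \<epsilon> by (rule tree_matching_converse)
  define M N where "M = LCA T (fst ` L)" and "N = LCA G (snd ` L)"
  have top: "(M, N) \<in> C"
    unfolding M_def N_def using nonempty by (intro couplingI) auto
  have le: "tle T m M" if mn: "(m, n) \<in> C" for m n
  proof -
    obtain I where I: "I \<subseteq> L" "I \<noteq> {}" "m = LCA T (fst ` I)"
      using couplingE[OF mn] by metis
    have "tle T v M" if "(v, w) \<in> I" for v w
      unfolding M_def using I that by (intro T.LCA_upper fst_subset) force+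
    then show ?thesis
      unfolding I(3) using I C_verts[OF top] by (intro LCA_fst_least) auto
  qed
  have strict: "tless T m m' \<longleftrightarrow> tless G n n'" if "(m, n) \<in> C" "(m', n') \<in> C" for m n m' n'
    using C_mono_iff[OF that] by (simp add: T.tless_iff G.tless_iff)
  have "{p \<in> C. \<not> (\<exists>q\<in>C. pair_less T G p q)} = {(M, N)}"
  proof (intro equalityI subrelI)
    fix m n assume mn: "(m, n) \<in> {p \<in> C. \<not> (\<exists>q\<in>C. pair_less T G p q)}"
    then have C: "(m, n) \<in> C" by simp
    have "\<not> tless T m M"
      using mn strict[OF C top] top by (force simp: pair_less_def)
    then have "m = M" using le[OF C] T.tless_iff by blast
    then show "(m, n) \<in> {(M, N)}" using C_mono_iff(2)[OF C top] by simp
  next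
    fix m n assume "(m, n) \<in> {(M, N)}"
    moreover have "\<not> tless T M m" if "(m, n) \<in> C" for m n
      using T.tle_height[OF le[OF that]] T.height_strict_mono[of M m] by force
    ultimately show "(m, n) \<in> {p \<in> C. \<not> (\<exists>q\<in>C. pair_less T G p q)}"
      using top by (auto simp: pair_less_def)
  qed
  then have "card {p \<in> C. \<not> (\<exists>q\<in>C. pair_less T G p q)} = 1" by simp
  moreover have "inj_on fst C" "inj_on snd C"
    using C_mono_iff(2) by (fastforce simp: inj_on_def)+
  moreover have "card (Lambda G (C\<inverse>) b) \<noteq> 1" if "b \<in> snd ` C" for b
    using conv.Lambda_not_single[of b] that
    by (simp add: cluster_coupling_converse fst_converse_image)
  ultimately show ?thesis
    unfolding couplings_def using C_verts strict Lambda_not_single by auto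
qed

lemma tree_coupling: "tree_coupling T G C"
  using cluster_coupling_in_couplings T.merge_tree_axioms G.merge_tree_axioms
  by (simp add: tree_coupling_def tree_coupling_axioms_def)

text \<open>The maximal coupled vertices below \<open>x\<close> together have the same pairs below them as \<open>x\<close> itself.\<close>

lemma chi_eq_LCA_partners:
  assumes x: "x \<in> deleted T C"
  shows "chi T G C x = LCA G (snd ` {p \<in> L. tle T (fst p) x})"
proof -
  let ?I = "{p \<in> L. tle T (fst p) x}"
  let ?W = "{w. \<exists>v. (v, w) \<in> C \<and> v \<in> Lambda T C x}"
  have "(\<forall>b\<in>?W. tle G b u) \<longleftrightarrow> (\<forall>b\<in>snd ` ?I. tle G b u)" if u: "u \<in> verts G" for u
  proof
    assume ub: "\<forall>b\<in>?W. tle G b u"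
    show "\<forall>b\<in>snd ` ?I. tle G b u"
    proof
      fix b assume "b \<in> snd ` ?I"
      then obtain a where a: "(a, b) \<in> L" "tle T a x" by auto
      then have aC: "(a, b) \<in> C" "a \<in> fst ` C" using L_subset_C by force+
      then have "a \<noteq> x" using x by (auto simp: deleted_def)
      then have "tless T a x" using a T.tless_iff by blast
      then obtain m where m: "m \<in> Lambda T C x" "tle T a m"
        using T.ex_Lambda[OF fst_C_verts aC(2)] by metis
      then obtain n where n: "(m, n) \<in> C" by (auto simp: Lambda_def)
      have "tle G b n" using C_mono[OF aC(1) n m(2)] .
      moreover have "tle G n u" using ub n m by blast
      ultimately show "tle G b u" by simp
    qed
  next
    assume ub: "\<forall>b\<in>snd ` ?I. tle G b u"
    show "\<forall>b\<in>?W. tle G b u"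
    proof
      fix n assume "n \<in> ?W"
      then obtain m where m: "(m, n) \<in> C" "m \<in> Lambda T C x" by blast
      then have mx: "tle T m x" by (auto simp: Lambda_def)
      obtain I where I: "I \<subseteq> L" "I \<noteq> {}" "n = LCA G (snd ` I)"
        "\<And>v w. (v, w) \<in> L \<Longrightarrow> (v, w) \<in> I \<longleftrightarrow> tle T v m"
        using couplingE[OF m(1)] by metis
      have "tle G w u" if vw: "(v, w) \<in> I" for v w
      proof -
        have "(v, w) \<in> L" "tle T v x" using I vw mx by (auto intro: rtrancl_trans)
        then have "w \<in> snd ` ?I" by force
        then show ?thesis using ub by blast
      qed
      then show "tle G n u" unfolding I(3) using I u by (intro LCA_snd_least) auto
    qed
  qed
  then have "is_lub G ?W u \<longleftrightarrow> is_lub G (snd ` ?I) u" for u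
    unfolding is_lub_def by (simp cong: conj_cong imp_cong ball_cong)
  then show ?thesis by (simp add: chi_def LCA_def)
qed

text \<open>Only the bound of \<open>f(x)\<close> by \<open>g(n) + \<epsilon>\<close> for \<open>n = \<chi>(x)\<close> needs an argument. If the pairs below \<open>x\<close> were
  exactly the pairs below \<open>n\<close>, they would form a common cluster; then \<open>x\<close> would have a single
  maximal coupled vertex below it and be unused. So some pair is below \<open>n\<close> but not below \<open>x\<close>: on the side
  of \<open>T\<close> it merges with the pairs below \<open>x\<close> only above \<open>x\<close>, while on the side of \<open>G\<close> it has merged
  with them at \<open>n\<close>.\<close>

lemma branch_cost:
  assumes x: "x \<in> deleted T C" and card: "card (Lambda T C x) > 1"
  shows "\<bar>height G (chi T G C x) - height T x\<bar> \<le> \<epsilon>"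
proof -
  define I where "I = {p \<in> L. tle T (fst p) x}"
  define m n where "m = LCA T (fst ` I)" and "n = LCA G (snd ` I)"
  have n: "chi T G C x = n"
    using chi_eq_LCA_partners[OF x] by (simp add: n_def I_def)
  have xT: "x \<in> verts T" and xC: "x \<notin> fst ` C" using x by (auto simp: deleted_def)
  have IL: "I \<subseteq> L" "\<And>v w. (v, w) \<in> I \<Longrightarrow> tle T v x" by (auto simp: I_def)
  have "Lambda T C x \<noteq> {}" using card by auto
  then obtain u where u: "u \<in> fst ` C" "tless T u x" by (auto simp: Lambda_def)
  obtain v w where vw: "(v, w) \<in> L" "tle T v u" using pair_below_coupled[OF u(1)] .
  then have vwI: "(v, w) \<in> I" using u by (auto simp: I_def T.tless_iff intro: rtrancl_trans)
  then have ne: "I \<noteq> {}" by auto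
  have upper: "height G n \<le> height T x + \<epsilon>"
    unfolding n_def using LCA_partners_bound[OF IL(1) ne xT] IL(2) by blast
  have mx: "tle T m x"
    unfolding m_def using LCA_fst_least[OF IL(1) ne xT] IL(2) by blast
  have mI: "tle T a m" if "(a, b) \<in> I" for a b
    unfolding m_def using that by (intro T.LCA_upper fst_subset[OF IL(1)]) force
  have nI: "tle G b n" if "(a, b) \<in> I" for a b
    unfolding n_def using that by (intro G.LCA_upper snd_subset[OF IL(1)]) force
  have closed_T: "(a, b) \<in> I" if "(a, b) \<in> L" "tle T a m" for a b
    using that mx by (auto simp: I_def intro: rtrancl_trans)
  have "\<exists>a b. (a, b) \<in> L \<and> tle G b n \<and> (a, b) \<notin> I"
  proof (rule ccontr)
    assume none: "\<not> ?thesis"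
    have mn: "(m, n) \<in> C"
      unfolding m_def n_def
    proof (rule couplingI[OF IL(1) ne])
      show "(a, b) \<in> I" if "(a, b) \<in> L" "tle T a (LCA T (fst ` I))" for a b
        using closed_T that by (simp add: m_def)
      show "(a, b) \<in> I" if "(a, b) \<in> L" "tle G b (LCA G (snd ` I))" for a b
        using none that by (simp add: n_def)
    qed
    then have mC: "m \<in> fst ` C" by force
    then have m_less: "tless T m x" using mx xC T.tless_iff by blast
    have below_m: "tle T u m" if u: "u \<in> fst ` C" "tless T u x" for u
    proof -
      obtain u' where "(u, u') \<in> C" using u by auto
      then obtain I' where I': "I' \<subseteq> L" "I' \<noteq> {}" "u = LCA T (fst ` I')"
        "\<And>v w. (v, w) \<in> L \<Longrightarrow> (v, w) \<in> I' \<longleftrightarrow> tle T v u"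
        using couplingE by metis
      have "tle T a m" if ab: "(a, b) \<in> I'" for a b
      proof -
        have "(a, b) \<in> L" "tle T a x"
          using I' ab u(2) by (auto simp: T.tless_iff intro: rtrancl_trans)
        then show ?thesis using mI[of a b] by (simp add: I_def)
      qed
      then show ?thesis
        unfolding I'(3) using I' mC fst_C_verts by (intro LCA_fst_least) auto
    qed
    have "Lambda T C x = {m}"
    proof (intro equalityI subsetI)
      fix u assume u: "u \<in> Lambda T C x"
      then have "tle T u m" "\<not> tless T u m"
        using below_m mC m_less by (auto simp: Lambda_def)
      then show "u \<in> {m}" by (simp add: T.tless_iff)
    next
      fix u assume "u \<in> {m}"
      moreover have "\<not> tless T m a" if "a \<in> fst ` C" "tless T a x" for a
        using T.tle_height[OF below_m[OF that]] T.height_strict_mono[of m a] by force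
      ultimately show "u \<in> Lambda T C x" using mC m_less by (auto simp: Lambda_def)
    qed
    then show False using card by simp
  qed
  then obtain a b where ab: "(a, b) \<in> L" "tle G b n" "(a, b) \<notin> I" by blast
  have V: "v \<in> verts T" "a \<in> verts T" "w \<in> verts G" "b \<in> verts G"
    using pair_verts vw ab by auto
  have "\<not> merge_height T v a \<le> height T x"
    using T.tle_of_merge_height[of v a x] V IL(2)[OF vwI] ab by (auto simp: I_def)
  moreover have "merge_height T v a \<le> merge_height G w b + \<epsilon>"
    using dist_T vw(1) ab(1) by blast
  moreover have "merge_height G w b \<le> height G n"
    using G.merge_height_le V ab(2) nI[OF vwI] by blast
  ultimately show ?thesis using upper unfolding n by linarith
qed

text \<open>Every coupled vertex lies above a vertex of the matching, so \<open>\<phi>(x)\<close> is the place where \<open>x\<close> first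
  merges with a vertex of the matching.\<close>

lemma leaf_cost:
  assumes x: "x \<in> deleted T C" "Lambda T C x = {}"
  shows "height T x \<le> height T (phi T C x)" "height T (phi T C x) \<le> height T x + 2 * \<epsilon>"
    "height G (eta T G C x) \<le> height T x + \<epsilon>"
proof -
  interpret tc: tree_coupling T G C by (rule tree_coupling)
  have xT: "x \<in> verts T" using x by (simp add: deleted_def)
  obtain v w where vw: "(v, w) \<in> L" "merge_height T x v \<le> height T x + 2 * \<epsilon>"
      "height G w \<le> height T x + \<epsilon>"
    and nearest: "\<And>v' w'. (v', w') \<in> L \<Longrightarrow> merge_height T x v \<le> merge_height T x v'"
    using nearest_T[OF xT] by blast
  have vT: "v \<in> verts T" using vw pair_verts by blast
  define p where "p = LCA T {x, v}"
  have p: "tle T x p" "tle T v p" "height T p = merge_height T x v"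
    unfolding p_def using xT vT by (auto simp: merge_height_def intro!: T.LCA_upper)
  have vC: "(v, w) \<in> C" "v \<in> fst ` C" using vw L_subset_C by force+
  then have "\<not> tle T v x" using tc.nothing_coupled_below[OF x] by blast
  then have xp: "tless T x p" using p T.tless_iff by blast
  have "phi T C x = p"
  proof (rule T.phi_eqI[OF xT xp vC(2) p(2)])
    fix u c assume u: "tless T x u" "c \<in> fst ` C" "tle T c u"
    obtain a b where ab: "(a, b) \<in> L" "tle T a c" using pair_below_coupled[OF u(2)] .
    have "tle T a u" using ab(2) u(3) by (rule rtrancl_trans)
    then have "merge_height T x a \<le> height T u"
      using T.merge_height_le[of x a u] xT pair_verts[OF ab(1)] u(1) by (simp add: T.tless_iff)
    then have "height T p \<le> height T u" using nearest[OF ab(1)] p by simp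
    then show "tle T p u" using T.tle_chain[OF p(1)] u T.tless_iff by blast
  qed
  then show "height T x \<le> height T (phi T C x)" "height T (phi T C x) \<le> height T x + 2 * \<epsilon>"
    "height G (eta T G C x) \<le> height T x + \<epsilon>"
    using p vw tc.eta_le[OF vC(1), of x] T.tle_height[OF p(1)] by auto
qed

lemma vertex_map_cost:
  assumes "x \<in> verts T - unused T C"
  shows "\<bar>mheight (vertex_map T G C x) - height T x\<bar> \<le> \<epsilon>"
proof -
  interpret tc: tree_coupling T G C by (rule tree_coupling)
  interpret conv: tree_matching G T "L\<inverse>" \<epsilon> by (rule tree_matching_converse)
  show ?thesis
    using assms
  proof (cases rule: tc.not_unused_cases)
    case (1 y)
    then have "height T x \<le> height G y + \<epsilon>"
      using conv.matched_height_le[of y x] by (simp add: cluster_coupling_converse)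
    then show ?thesis
      using matched_height_le[OF 1] tc.vertex_map_matched[OF 1] by (simp add: abs_le_iff)
  next
    case 2
    then show ?thesis using branch_cost tc.vertex_map_branch by simp
  next
    case 3
    then show ?thesis
      using leaf_cost[OF 3] unfolding tc.mheight_vertex_map_leaf[OF 3]
      by (auto simp: abs_le_iff max_def field_simps)
  qed
qed

lemma cost_cluster_coupling: "cost T G C \<le> \<epsilon>"
proof -
  interpret tc: tree_coupling T G C by (rule tree_coupling)
  interpret conv: tree_matching G T "L\<inverse>" \<epsilon> by (rule tree_matching_converse)
  show ?thesis
    using vertex_map_cost conv.vertex_map_cost
    by (simp add: tc.cost_le_iff cluster_coupling_converse)
qed

end

lemma (in order_interleaving) ex_cheap_coupling: "\<exists>C\<in>couplings T G. cost T G C \<le> \<epsilon>"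
proof -
  obtain L where L: "matching L" "nearest_cheap L"
    using ex_nearest_cheap[OF matching_lowest_pairs covering_lowest_pairs] .
  note D = matchingD[OF L(1)]
  have L_verts: "v \<in> verts T \<and> w \<in> verts G" if "(v, w) \<in> L" for v w
    using D(1,2)[OF that] by simp
  have sep: "height T v < merge_height T v v'" "height G w < merge_height G w w'"
    if "(v, w) \<in> L" "(v', w') \<in> L" "(v, w) \<noteq> (v', w')" for v w v' w'
    using L(1) that L_verts[OF that(1)] T.merge_height_self[of v] G.merge_height_self[of w]
    unfolding matching_def by fastforce+
  interpret tree_matching T G L \<epsilon>
  proof
    show "L \<noteq> {}"
      using L(2) T.root_in_verts by (auto simp: nearest_cheap_def)
    show "v \<in> verts T \<and> w \<in> verts G" if "(v, w) \<in> L" for v w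
      using L_verts that .
    show "(v, w) = (v', w')" if "(v, w) \<in> L" "(v', w') \<in> L" "tle T v v'" for v w v' w'
      using sep(1)[OF that(2,1)] T.merge_height_le[of v' v v'] that L_verts by force
    show "(v, w) = (v', w')" if "(v, w) \<in> L" "(v', w') \<in> L" "tle G w w'" for v w v' w'
      using sep(2)[OF that(2,1)] G.merge_height_le[of w' w w'] that L_verts by force
    show "merge_height T v v' \<le> merge_height G w w' + \<epsilon>"
      "merge_height G w w' \<le> merge_height T v v' + \<epsilon>"
      if "(v, w) \<in> L" "(v', w') \<in> L" for v w v' w'
      using D(5,6)[OF that(1) that(2)] by simp_all
    show "\<exists>v w. (v, w) \<in> L \<and>
      (\<forall>v' w'. (v', w') \<in> L \<longrightarrow> merge_height T x v \<le> merge_height T x v') \<and>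
      merge_height T x v \<le> height T x + 2 * \<epsilon> \<and> height G w \<le> height T x + \<epsilon>"
      if x: "x \<in> verts T" for x
    proof -
      obtain p where p: "p \<in> L" "\<forall>q\<in>L. merge_height T x (fst p) \<le> merge_height T x (fst q)"
        "merge_height T x (fst p) \<le> merge_height T x x + 2 * \<epsilon>"
        "merge_height G (snd p) (snd p) \<le> merge_height T x x + \<epsilon>"
        using L(2) x unfolding nearest_cheap_def by blast
      then show ?thesis
        using x D(1,2)[OF p(1)]
        by (intro exI[of _ "fst p"] exI[of _ "snd p"])
           (force simp: T.merge_height_self G.merge_height_self)
    qed
    show "\<exists>v w. (v, w) \<in> L \<and>
      (\<forall>v' w'. (v', w') \<in> L \<longrightarrow> merge_height G y w \<le> merge_height G y w') \<and>
      merge_height G y w \<le> height G y + 2 * \<epsilon> \<and> height T v \<le> height G y + \<epsilon>"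
      if y: "y \<in> verts G" for y
    proof -
      obtain p where p: "p \<in> L" "\<forall>q\<in>L. merge_height G y (snd p) \<le> merge_height G y (snd q)"
        "merge_height G y (snd p) \<le> merge_height G y y + 2 * \<epsilon>"
        "merge_height T (fst p) (fst p) \<le> merge_height G y y + \<epsilon>"
        using L(2) y unfolding nearest_cheap_def by blast
      then show ?thesis
        using y D(1,2)[OF p(1)]
        by (intro exI[of _ "fst p"] exI[of _ "snd p"])
           (force simp: T.merge_height_self G.merge_height_self)
    qed
  qed
  show ?thesis using cluster_coupling_in_couplings cost_cluster_coupling by blast
qed

theorem mainTheorem3:
  fixes T :: "'a mtree" and G :: "'b mtree"
  assumes "merge_tree T" and "merge_tree G"
  shows "interleaving_distance T G = Min (cost T G ` couplings T G)"
proof -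
  let ?c = "Min (cost T G ` couplings T G)"
  have fin: "finite (cost T G ` couplings T G)" "cost T G ` couplings T G \<noteq> {}"
    using finite_couplings[OF assms] couplings_nonempty[OF assms] by auto
  then obtain C where C: "C \<in> couplings T G" "?c = cost T G C"
    using Min_in by (metis imageE)
  interpret tree_coupling T G C
    using assms C(1) by (simp add: tree_coupling_def tree_coupling_axioms_def)
  have "?c \<le> \<epsilon>" if "0 \<le> \<epsilon>" "compatible_maps T G \<epsilon> \<alpha> \<beta>" for \<epsilon> \<alpha> \<beta>
  proof -
    interpret order_interleaving T G \<epsilon> \<alpha> \<beta>
      using order_interleaving_if_compatible[OF assms that] .
    obtain C' where "C' \<in> couplings T G" "cost T G C' \<le> \<epsilon>"
      using ex_cheap_coupling by blast
    then show ?thesis using fin by (meson Min_le imageI order_trans)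
  qed
  moreover have "0 \<le> ?c" "\<exists>\<alpha> \<beta>. compatible_maps T G ?c \<alpha> \<beta>"
    using cost_nonneg compatible_maps_cost C(2) by auto
  ultimately show ?thesis
    unfolding interleaving_distance_def by (intro cInf_eq_minimum) auto
qed

end
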